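(* Let $X\in\mathbf{B}_3$ with $e(X)=2$. Then the Hurwitz action on the set of quasipositive factorizations of $X$ has at most two orbits.
   Context: $\mathbf{B}_3=\langle\sigma_1,\sigma_2\mid\sigma_1\sigma_2\sigma_1=\sigma_2\sigma_1\sigma_2\rangle$ is the group of braids with three strings, and $e:\mathbf{B}_3\to\mathbb{Z}$ is the group homomorphism with $e(\sigma_1)=e(\sigma_2)=1$. A quasipositive factorization of $X\in\mathbf{B}_3$ is a tuple $(X_1,\dots,X_k)\in\mathbf{B}_3^k$ such that $X_1\cdots X_k=X$ and each $X_i$ is conjugate in $\mathbf{B}_3$ to $\sigma_1$. (Necessarily $k=e(X)$.) For a group $G$ and $1\le i<k$, define $\Sigma_i:G^k\to G^k$ by $\Sigma_i(X_1,\dots,X_k)=(Y_1,\dots,Y_k)$ where $(Y_i,Y_{i+1})=(X_iX_{i+1}X_i^{-1},X_i)$ and $Y_j=X_j$ for $j\notin\{i,i+1\}$. These maps are invertible, and $\sigma_i\mapsto\Sigma_i$ defines an action of the braid group $\mathbf{B}_k$ on $G^k$, called the Hurwitz action. With $G=\mathbf{B}_3$ it preserves the set of quasipositive factorizations of a given braid. *)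

theory Defs
  imports "HOL-Algebra.Group_Action" "HOL-Algebra.Elementary_Groups"
begin

section \<open>Groups given by generators and relations\<close>

text \<open>A word over the generators \<open>S\<close> is a list of letters \<open>(s, b)\<close>; the letter \<open>(s, True)\<close> stands
  for \<open>s\<close> and \<open>(s, False)\<close> for its inverse.\<close>

type_synonym 'a word = "('a \<times> bool) list"

definition words :: "'a set \<Rightarrow> 'a word set" where
  "words S = lists (S \<times> UNIV)"

inductive pres_eq :: "'a set \<Rightarrow> ('a word \<times> 'a word) set \<Rightarrow> 'a word \<Rightarrow> 'a word \<Rightarrow> bool"
  for S :: "'a set" and R :: "('a word \<times> 'a word) set" where
  refl: "w \<in> words S \<Longrightarrow> pres_eq S R w w"
| sym: "pres_eq S R v w \<Longrightarrow> pres_eq S R w v"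
| trans: "pres_eq S R u v \<Longrightarrow> pres_eq S R v w \<Longrightarrow> pres_eq S R u w"
| cancel: "u \<in> words S \<Longrightarrow> v \<in> words S \<Longrightarrow> s \<in> S \<Longrightarrow>
    pres_eq S R (u @ [(s, b), (s, \<not> b)] @ v) (u @ v)"
| relator: "u \<in> words S \<Longrightarrow> v \<in> words S \<Longrightarrow> (r, r') \<in> R \<Longrightarrow>
    pres_eq S R (u @ r @ v) (u @ r' @ v)"

definition pres_rel :: "'a set \<Rightarrow> ('a word \<times> 'a word) set \<Rightarrow> ('a word \<times> 'a word) set" where
  "pres_rel S R = {(v, w). pres_eq S R v w}"

definition presented_group :: "'a set \<Rightarrow> ('a word \<times> 'a word) set \<Rightarrow> 'a word set monoid" where
  "presented_group S R =
    \<lparr>carrier = words S // pres_rel S R,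
     monoid.mult = (\<lambda>A B. \<Union>u\<in>A. \<Union>v\<in>B. pres_rel S R `` {u @ v}),
     one = pres_rel S R `` {[]}\<rparr>"

lemma words_append [simp]: "u @ v \<in> words S \<longleftrightarrow> u \<in> words S \<and> v \<in> words S"
  by (auto simp: words_def)

lemma words_Nil [simp]: "[] \<in> words S"
  by (simp add: words_def)

lemma words_Cons [simp]: "(s, b) # w \<in> words S \<longleftrightarrow> s \<in> S \<and> w \<in> words S"
  by (auto simp: words_def)

locale presentation =
  fixes S :: "'a set" and R :: "('a word \<times> 'a word) set"
  assumes R_words: "R \<subseteq> words S \<times> words S"
begin

lemma pres_eq_words: "pres_eq S R v w \<Longrightarrow> v \<in> words S \<and> w \<in> words S"
  by (induction rule: pres_eq.induct) (use R_words in auto)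

lemma equiv_pres_rel: "equiv (words S) (pres_rel S R)"
  unfolding equiv_def refl_on_def sym_def trans_def pres_rel_def
  using pres_eq_words by (auto intro: pres_eq.intros)

lemma pres_eq_context:
  assumes "pres_eq S R v w" "x \<in> words S" "y \<in> words S"
  shows "pres_eq S R (x @ v @ y) (x @ w @ y)"
  using assms
proof (induction rule: pres_eq.induct)
  case (cancel u v s b)
  then show ?case
    using pres_eq.cancel[of "x @ u" S "v @ y" s R b] by simp
next
  case (relator u v r r')
  then show ?case
    using pres_eq.relator[of "x @ u" S "v @ y" r r' R] by simp
qed (auto intro: pres_eq.intros)

lemma pres_eq_append:
  assumes "pres_eq S R v v'" "pres_eq S R w w'"
  shows "pres_eq S R (v @ w) (v' @ w')"
proof -
  have "pres_eq S R (v @ w) (v' @ w)"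
    using pres_eq_context[OF assms(1), of "[]" w] pres_eq_words[OF assms(2)] by simp
  moreover have "pres_eq S R (v' @ w) (v' @ w')"
    using pres_eq_context[OF assms(2), of v' "[]"] pres_eq_words[OF assms(1)] by simp
  ultimately show ?thesis
    by (rule pres_eq.trans)
qed

abbreviation cls :: "'a word \<Rightarrow> 'a word set" where
  "cls w \<equiv> pres_rel S R `` {w}"

abbreviation grp ("\<G>") where "\<G> \<equiv> presented_group S R"

lemma cls_eq: "pres_eq S R v w \<Longrightarrow> cls v = cls w"
  using equiv_class_eq[OF equiv_pres_rel, of v w] by (simp add: pres_rel_def)

lemma cls_self: "w \<in> words S \<Longrightarrow> w \<in> cls w"
  by (simp add: pres_rel_def pres_eq.refl)

lemma carrier_cls: "w \<in> words S \<Longrightarrow> cls w \<in> carrier \<G>"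
  by (simp add: presented_group_def quotientI)

lemma carrierE:
  assumes "A \<in> carrier \<G>"
  obtains w where "w \<in> words S" "A = cls w"
  using assms by (auto simp: presented_group_def elim: quotientE)

lemma cls_mult:
  assumes "v \<in> words S" "w \<in> words S"
  shows "cls v \<otimes>\<^bsub>\<G>\<^esub> cls w = cls (v @ w)"
proof -
  have "congruent2 (pres_rel S R) (pres_rel S R) (\<lambda>u v. cls (u @ v))"
    unfolding congruent2_def by (auto simp: pres_rel_def intro!: pres_eq_append
      dest: cls_eq[OF pres_eq_append, unfolded pres_rel_def])
  from UN_equiv_class2[OF equiv_pres_rel equiv_pres_rel this assms]
  show ?thesis by (simp add: presented_group_def)
qed

lemma cls_one: "\<one>\<^bsub>\<G>\<^esub> = cls []"
  by (simp add: presented_group_def)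

definition inv_word :: "'a word \<Rightarrow> 'a word" where
  "inv_word w = rev (map (\<lambda>(s, b). (s, \<not> b)) w)"

lemma inv_word_words [simp]: "w \<in> words S \<Longrightarrow> inv_word w \<in> words S"
  by (auto simp: inv_word_def words_def)

lemma inv_word_left: "w \<in> words S \<Longrightarrow> pres_eq S R (inv_word w @ w) []"
proof (induction w)
  case Nil
  then show ?case by (simp add: inv_word_def pres_eq.refl)
next
  case (Cons x w)
  obtain s b where x: "x = (s, b)" by force
  have "pres_eq S R (inv_word w @ [(s, \<not> b), (s, \<not> \<not> b)] @ w) (inv_word w @ w)"
    by (rule pres_eq.cancel) (use Cons.prems x in auto)
  then show ?case
    using Cons x by (auto simp: inv_word_def intro: pres_eq.trans)
qed

theorem group_presented: "group \<G>"
proof (rule groupI)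
  show "\<one>\<^bsub>\<G>\<^esub> \<in> carrier \<G>" by (simp add: cls_one carrier_cls)
next
  fix A B assume "A \<in> carrier \<G>" "B \<in> carrier \<G>"
  then show "A \<otimes>\<^bsub>\<G>\<^esub> B \<in> carrier \<G>"
    by (elim carrierE) (simp add: cls_mult carrier_cls)
next
  fix A B C assume "A \<in> carrier \<G>" "B \<in> carrier \<G>" "C \<in> carrier \<G>"
  then show "A \<otimes>\<^bsub>\<G>\<^esub> B \<otimes>\<^bsub>\<G>\<^esub> C = A \<otimes>\<^bsub>\<G>\<^esub> (B \<otimes>\<^bsub>\<G>\<^esub> C)"
    by (elim carrierE) (simp add: cls_mult)
next
  fix A assume "A \<in> carrier \<G>"
  then show "\<one>\<^bsub>\<G>\<^esub> \<otimes>\<^bsub>\<G>\<^esub> A = A"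
    by (elim carrierE) (simp add: cls_mult cls_one)
next
  fix A assume "A \<in> carrier \<G>"
  then obtain w where "w \<in> words S" "A = cls w" by (rule carrierE)
  then show "\<exists>B\<in>carrier \<G>. B \<otimes>\<^bsub>\<G>\<^esub> A = \<one>\<^bsub>\<G>\<^esub>"
    by (intro bexI[of _ "cls (inv_word w)"])
      (simp_all add: cls_mult cls_one carrier_cls cls_eq inv_word_left)
qed

lemma rep_in_class:
  assumes "A \<in> carrier \<G>"
  shows "(SOME w. w \<in> A) \<in> A"
  using assms by (elim carrierE) (metis cls_self someI)

lemma rep_cls:
  assumes "w \<in> words S"
  shows "pres_eq S R w (SOME v. v \<in> cls w)"
  using rep_in_class[OF carrier_cls[OF assms]] by (simp add: pres_rel_def)

end

section \<open>Braid groups\<close>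

type_synonym braid = "nat word set"

definition braid_relations :: "nat \<Rightarrow> (nat word \<times> nat word) set" where
  "braid_relations n =
    {([(i, True), (i + 1, True), (i, True)], [(i + 1, True), (i, True), (i + 1, True)]) | i.
       1 \<le> i \<and> i + 1 < n} \<union>
    {([(i, True), (j, True)], [(j, True), (i, True)]) | i j. 1 \<le> i \<and> i + 1 < j \<and> j < n}"

definition braid_group :: "nat \<Rightarrow> braid monoid" where
  "braid_group n = presented_group {1..<n} (braid_relations n)"

definition braid_gen :: "nat \<Rightarrow> nat \<Rightarrow> braid" where
  "braid_gen n i = pres_rel {1..<n} (braid_relations n) `` {[(i, True)]}"

definition exponent_word :: "'a word \<Rightarrow> int" where
  "exponent_word w = (\<Sum>(s, b)\<leftarrow>w. if b then 1 else - 1)"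

text \<open>The exponent sum is constant on each class; see \<open>braid_exponent_hom\<close> and
  \<open>braid_exponent_gen\<close> below.\<close>

definition braid_exponent :: "braid \<Rightarrow> int" where
  "braid_exponent A = exponent_word (SOME w. w \<in> A)"

lemma braid_relations_3:
  "braid_relations 3 =
    {([(1, True), (2, True), (1, True)], [(2, True), (1, True), (2, True)])}"
proof -
  have 1: "1 \<le> i \<and> i + 1 < 3 \<longleftrightarrow> i = 1" for i :: nat by auto
  have 2: "(1 \<le> i \<and> i + 1 < j \<and> j < 3) \<longleftrightarrow> False" for i j :: nat by auto
  show ?thesis
    unfolding braid_relations_def 1 2 by (simp add: numeral_2_eq_2)
qed

interpretation braid: presentation "{1..<n}" "braid_relations n" for n
  by standard (auto simp: braid_relations_def)

lemma group_braid_group: "group (braid_group n)"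
  unfolding braid_group_def by (rule braid.group_presented)

lemma braid_gen_carrier: "1 \<le> i \<Longrightarrow> i < n \<Longrightarrow> braid_gen n i \<in> carrier (braid_group n)"
  unfolding braid_group_def braid_gen_def by (rule braid.carrier_cls) auto

lemma braid_gen_relation:
  assumes "1 \<le> i" "i + 1 < n"
  shows "braid_gen n i \<otimes>\<^bsub>braid_group n\<^esub> braid_gen n (i + 1) \<otimes>\<^bsub>braid_group n\<^esub> braid_gen n i =
    braid_gen n (i + 1) \<otimes>\<^bsub>braid_group n\<^esub> braid_gen n i \<otimes>\<^bsub>braid_group n\<^esub> braid_gen n (i + 1)"
proof -
  have "pres_eq {1..<n} (braid_relations n)
     ([] @ [(i, True), (i + 1, True), (i, True)] @ [])
     ([] @ [(i + 1, True), (i, True), (i + 1, True)] @ [])"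
    by (rule pres_eq.relator) (use assms in \<open>auto simp: braid_relations_def\<close>)
  from braid.cls_eq[OF this] show ?thesis
    using assms unfolding braid_group_def braid_gen_def by (simp add: braid.cls_mult del: One_nat_def)
qed

lemma exponent_word_append [simp]: "exponent_word (u @ v) = exponent_word u + exponent_word v"
  by (simp add: exponent_word_def)

lemma exponent_word_pres_eq:
  "pres_eq {1..<n} (braid_relations n) v w \<Longrightarrow> exponent_word v = exponent_word w"
  by (induction rule: pres_eq.induct) (auto simp: exponent_word_def braid_relations_def)

lemma braid_exponent_cls:
  assumes "w \<in> words {1..<n}"
  shows "braid_exponent (braid.cls n w) = exponent_word w"
  unfolding braid_exponent_def
  using exponent_word_pres_eq[OF braid.rep_cls[OF assms]] by simp

lemma braid_exponent_hom: "braid_exponent \<in> hom (braid_group n) integer_group"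
  unfolding hom_def braid_group_def
  by (auto elim!: braid.carrierE simp: braid.cls_mult braid_exponent_cls simp del: One_nat_def)

lemma braid_exponent_gen: "1 \<le> i \<Longrightarrow> i < n \<Longrightarrow> braid_exponent (braid_gen n i) = 1"
  by (simp add: braid_gen_def braid_exponent_cls exponent_word_def del: One_nat_def)

section \<open>The Hurwitz action\<close>

text \<open>Tuples are lists, so the component \<open>X\<^sub>i\<close> is \<open>xs ! (i - 1)\<close>.\<close>

definition hurwitz_move :: "('g, 'm) monoid_scheme \<Rightarrow> nat \<Rightarrow> 'g list \<Rightarrow> 'g list" where
  "hurwitz_move G i xs =
    (let a = xs ! (i - 1); b = xs ! i
     in xs[i - 1 := a \<otimes>\<^bsub>G\<^esub> b \<otimes>\<^bsub>G\<^esub> inv\<^bsub>G\<^esub> a, i := a])"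

definition hurwitz_move_inv :: "('g, 'm) monoid_scheme \<Rightarrow> nat \<Rightarrow> 'g list \<Rightarrow> 'g list" where
  "hurwitz_move_inv G i xs =
    (let a = xs ! (i - 1); b = xs ! i
     in xs[i - 1 := b, i := inv\<^bsub>G\<^esub> b \<otimes>\<^bsub>G\<^esub> a \<otimes>\<^bsub>G\<^esub> b])"

definition hurwitz_letter :: "('g, 'm) monoid_scheme \<Rightarrow> nat \<times> bool \<Rightarrow> 'g list \<Rightarrow> 'g list" where
  "hurwitz_letter G l = (if snd l then hurwitz_move G (fst l) else hurwitz_move_inv G (fst l))"

text \<open>A braid acts through a word representing it, the last letter acting first; the choice of the
  word does not matter, see \<open>hurwitz_action_word\<close>. The result is an action of \<open>braid_group k\<close> on any
  set \<open>E\<close> of \<open>k\<close>-tuples closed under the moves, see \<open>group_action_hurwitz\<close>.\<close>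

definition hurwitz_action ::
  "('g, 'm) monoid_scheme \<Rightarrow> 'g list set \<Rightarrow> braid \<Rightarrow> 'g list \<Rightarrow> 'g list" where
  "hurwitz_action G E A = (\<lambda>xs\<in>E. foldr (hurwitz_letter G) (SOME w. w \<in> A) xs)"

lemma list_split2:
  assumes "1 \<le> i" "i < length xs"
  obtains us a b vs where "xs = us @ a # b # vs" "length us = i - 1"
proof
  show "xs = take (i - 1) xs @ xs ! (i - 1) # xs ! i # drop (i + 1) xs"
    using assms id_take_nth_drop[of "i - 1" xs] Cons_nth_drop_Suc[of i xs] by simp
  show "length (take (i - 1) xs) = i - 1"
    using assms by simp
qed

lemma list_split3:
  assumes "1 \<le> i" "i + 1 < length xs"
  obtains us a b c vs where "xs = us @ a # b # c # vs" "length us = i - 1"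
proof
  show "xs = take (i - 1) xs @ xs ! (i - 1) # xs ! i # xs ! (i + 1) # drop (i + 2) xs"
    using assms id_take_nth_drop[of "i - 1" xs] Cons_nth_drop_Suc[of i xs]
      Cons_nth_drop_Suc[of "i + 1" xs] by simp
  show "length (take (i - 1) xs) = i - 1"
    using assms by simp
qed

lemma hurwitz_move_split:
  assumes "1 \<le> i" "length us = i - 1"
  shows "hurwitz_move G i (us @ a # b # vs) = us @ (a \<otimes>\<^bsub>G\<^esub> b \<otimes>\<^bsub>G\<^esub> inv\<^bsub>G\<^esub> a) # a # vs"
proof -
  obtain j where "i = Suc j" using assms by (cases i) auto
  then show ?thesis
    using assms by (simp add: hurwitz_move_def Let_def nth_append list_update_append)
qed

lemma hurwitz_move_inv_split:
  assumes "1 \<le> i" "length us = i - 1"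
  shows "hurwitz_move_inv G i (us @ a # b # vs) = us @ b # (inv\<^bsub>G\<^esub> b \<otimes>\<^bsub>G\<^esub> a \<otimes>\<^bsub>G\<^esub> b) # vs"
proof -
  obtain j where "i = Suc j" using assms by (cases i) auto
  then show ?thesis
    using assms by (simp add: hurwitz_move_inv_def Let_def nth_append list_update_append)
qed

context group
begin

lemma conj_cancel:
  assumes "a \<in> carrier G" "b \<in> carrier G"
  shows "inv a \<otimes> (a \<otimes> b \<otimes> inv a) \<otimes> a = b" "b \<otimes> (inv b \<otimes> a \<otimes> b) \<otimes> inv b = a"
    "a \<otimes> b \<otimes> inv a \<otimes> a = a \<otimes> b" "b \<otimes> (inv b \<otimes> a \<otimes> b) = a \<otimes> b"
proof -
  have "inv x \<otimes> (x \<otimes> y) = y" "x \<otimes> (inv x \<otimes> y) = y"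
    if "x \<in> carrier G" "y \<in> carrier G" for x y
    using that by (simp_all flip: m_assoc)
  then show "inv a \<otimes> (a \<otimes> b \<otimes> inv a) \<otimes> a = b" "b \<otimes> (inv b \<otimes> a \<otimes> b) \<otimes> inv b = a"
    "a \<otimes> b \<otimes> inv a \<otimes> a = a \<otimes> b" "b \<otimes> (inv b \<otimes> a \<otimes> b) = a \<otimes> b"
    using assms by (simp_all add: m_assoc)
qed

lemma hurwitz_move_inverse:
  assumes "1 \<le> i" "i < length xs" "set xs \<subseteq> carrier G"
  shows "hurwitz_move_inv G i (hurwitz_move G i xs) = xs"
    and "hurwitz_move G i (hurwitz_move_inv G i xs) = xs"
proof -
  obtain us a b vs where xs: "xs = us @ a # b # vs" "length us = i - 1"
    using assms list_split2 by metis
  then have "a \<in> carrier G" "b \<in> carrier G" using assms by auto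
  then show "hurwitz_move_inv G i (hurwitz_move G i xs) = xs"
    "hurwitz_move G i (hurwitz_move_inv G i xs) = xs"
    using assms(1) xs by (simp_all add: hurwitz_move_split[of i] hurwitz_move_inv_split[of i] conj_cancel(1,2))
qed

lemma hurwitz_move_braid:
  assumes "1 \<le> i" "i + 1 < length xs" "set xs \<subseteq> carrier G"
  shows "hurwitz_move G i (hurwitz_move G (i + 1) (hurwitz_move G i xs)) =
    hurwitz_move G (i + 1) (hurwitz_move G i (hurwitz_move G (i + 1) xs))"
proof -
  obtain us a b c vs where xs: "xs = us @ a # b # c # vs" "length us = i - 1"
    using assms list_split3 by metis
  have m1: "hurwitz_move G i (us @ x # y # z) = us @ (x \<otimes> y \<otimes> inv x) # x # z" for x y z
    using assms(1) xs(2) by (rule hurwitz_move_split)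
  have m2: "hurwitz_move G (i + 1) (us @ t # x # y # z) = us @ t # (x \<otimes> y \<otimes> inv x) # x # z"
    for t x y z
    using hurwitz_move_split[of "i + 1" "us @ [t]" G x y z] assms(1) xs(2) by simp
  have abc: "a \<in> carrier G" "b \<in> carrier G" "c \<in> carrier G" using assms(3) xs(1) by auto
  have "inv a \<otimes> (a \<otimes> x) = x" if "x \<in> carrier G" for x
    using abc that by (simp add: flip: m_assoc)
  then show ?thesis
    unfolding xs(1) m1 m2 using abc by (simp add: m_assoc inv_mult_group)
qed

lemma hurwitz_move_commute:
  assumes "1 \<le> i" "i + 1 < j" "j < length xs"
  shows "hurwitz_move G i (hurwitz_move G j xs) = hurwitz_move G j (hurwitz_move G i xs)"
proof -
  have bounds: "i < length xs" "i - 1 < length xs" "j - 1 < length xs" using assms by auto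
  have "i - 1 \<noteq> j - 1" "i - 1 \<noteq> j" "i \<noteq> j - 1" "i \<noteq> j" using assms by auto
  then show ?thesis
    using bounds assms(3)
    by (intro nth_equalityI) (auto simp: hurwitz_move_def Let_def nth_list_update)
qed

end

locale hurwitz_set = group G for G :: "('g, 'm) monoid_scheme" (structure) +
  fixes k :: nat and E :: "'g list set"
  assumes tuples: "xs \<in> E \<Longrightarrow> length xs = k \<and> set xs \<subseteq> carrier G"
    and move_closed: "xs \<in> E \<Longrightarrow> 1 \<le> i \<Longrightarrow> i < k \<Longrightarrow> hurwitz_move G i xs \<in> E"
    and move_inv_closed: "xs \<in> E \<Longrightarrow> 1 \<le> i \<Longrightarrow> i < k \<Longrightarrow> hurwitz_move_inv G i xs \<in> E"
begin

lemma letter_closed: "xs \<in> E \<Longrightarrow> fst l \<in> {1..<k} \<Longrightarrow> hurwitz_letter G l xs \<in> E"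
  by (auto simp: hurwitz_letter_def move_closed move_inv_closed)

lemma word_closed: "xs \<in> E \<Longrightarrow> w \<in> words {1..<k} \<Longrightarrow> foldr (hurwitz_letter G) w xs \<in> E"
  by (induction w) (auto simp: letter_closed)

lemma word_pres_eq:
  assumes "pres_eq {1..<k} (braid_relations k) v w" "xs \<in> E"
  shows "foldr (hurwitz_letter G) v xs = foldr (hurwitz_letter G) w xs"
  using assms
proof (induction arbitrary: xs rule: pres_eq.induct)
  case (cancel u v s b)
  define ys where "ys = foldr (hurwitz_letter G) v xs"
  have "ys \<in> E" unfolding ys_def using cancel by (intro word_closed)
  then have "hurwitz_letter G (s, b) (hurwitz_letter G (s, \<not> b) ys) = ys"
    using tuples[of ys] cancel by (auto simp: hurwitz_letter_def hurwitz_move_inverse)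
  then show ?case by (simp add: ys_def)
next
  case (relator u v r r')
  define ys where "ys = foldr (hurwitz_letter G) v xs"
  have "ys \<in> E" unfolding ys_def using relator by (intro word_closed)
  then have "foldr (hurwitz_letter G) r ys = foldr (hurwitz_letter G) r' ys"
    using tuples[of ys] relator hurwitz_move_braid[of _ ys] hurwitz_move_commute[of _ _ ys]
    by (auto simp: hurwitz_letter_def braid_relations_def)
  then show ?case by (simp add: ys_def)
qed auto

lemma hurwitz_action_word:
  assumes "w \<in> words {1..<k}" "xs \<in> E"
  shows "hurwitz_action G E (braid.cls k w) xs = foldr (hurwitz_letter G) w xs"
  using word_pres_eq[OF braid.rep_cls[OF assms(1)] assms(2)] assms(2)
  by (simp add: hurwitz_action_def)

lemma hurwitz_action_gen:
  assumes "1 \<le> i" "i < k" "xs \<in> E"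
  shows "hurwitz_action G E (braid_gen k i) xs = hurwitz_move G i xs"
  using assms by (simp add: braid_gen_def hurwitz_action_word hurwitz_letter_def del: One_nat_def)

lemma hurwitz_action_closed:
  assumes "A \<in> carrier (braid_group k)" "xs \<in> E"
  shows "hurwitz_action G E A xs \<in> E"
  using assms unfolding braid_group_def
  by (auto elim!: braid.carrierE simp: hurwitz_action_word word_closed simp del: One_nat_def)

lemma hurwitz_action_one: "xs \<in> E \<Longrightarrow> hurwitz_action G E \<one>\<^bsub>braid_group k\<^esub> xs = xs"
  by (simp add: braid_group_def braid.cls_one hurwitz_action_word del: One_nat_def)

lemma hurwitz_action_mult:
  assumes "A \<in> carrier (braid_group k)" "B \<in> carrier (braid_group k)" "xs \<in> E"
  shows "hurwitz_action G E (A \<otimes>\<^bsub>braid_group k\<^esub> B) xs =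
    hurwitz_action G E A (hurwitz_action G E B xs)"
  using assms unfolding braid_group_def
  by (auto elim!: braid.carrierE simp: braid.cls_mult hurwitz_action_word word_closed simp del: One_nat_def)

lemma hurwitz_action_Bij:
  assumes A: "A \<in> carrier (braid_group k)"
  shows "hurwitz_action G E A \<in> Bij E"
proof -
  interpret B: group "braid_group k" by (rule group_braid_group)
  let ?B = "inv\<^bsub>braid_group k\<^esub> A"
  have "bij_betw (hurwitz_action G E A) E E"
  proof (rule bij_betw_byWitness[where f' = "hurwitz_action G E ?B"])
    show "\<forall>xs\<in>E. hurwitz_action G E ?B (hurwitz_action G E A xs) = xs"
      using A hurwitz_action_mult[of ?B A] by (simp add: hurwitz_action_one)
    show "\<forall>xs\<in>E. hurwitz_action G E A (hurwitz_action G E ?B xs) = xs"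
      using A hurwitz_action_mult[of A ?B] by (simp add: hurwitz_action_one)
  qed (use A hurwitz_action_closed in auto)
  then show ?thesis by (simp add: Bij_def hurwitz_action_def)
qed

theorem group_action_hurwitz: "group_action (braid_group k) E (hurwitz_action G E)"
proof -
  have "hurwitz_action G E (A \<otimes>\<^bsub>braid_group k\<^esub> B) =
      compose E (hurwitz_action G E A) (hurwitz_action G E B)"
    if "A \<in> carrier (braid_group k)" "B \<in> carrier (braid_group k)" for A B
  proof
    fix xs
    show "hurwitz_action G E (A \<otimes>\<^bsub>braid_group k\<^esub> B) xs =
        compose E (hurwitz_action G E A) (hurwitz_action G E B) xs"
      using that hurwitz_action_mult[of A B xs]
      by (cases "xs \<in> E") (simp_all add: compose_def hurwitz_action_def)
  qed
  then have "hurwitz_action G E \<in> hom (braid_group k) (BijGroup E)"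
    by (auto simp: hom_def BijGroup_def hurwitz_action_Bij)
  then show ?thesis
    by (simp add: group_action_def group_hom_def group_hom_axioms_def
        group_braid_group group_BijGroup)
qed

end

lemma (in group) hurwitz_set_tuples:
  "hurwitz_set G k {xs. length xs = k \<and> set xs \<subseteq> carrier G}"
proof
  fix xs i
  assume xs: "xs \<in> {xs. length xs = k \<and> set xs \<subseteq> carrier G}" and i: "1 \<le> i" "i < k"
  then have "i < length xs" by auto
  then obtain us a b vs where "xs = us @ a # b # vs" "length us = i - 1"
    using list_split2 i(1) by metis
  then show "hurwitz_move G i xs \<in> {xs. length xs = k \<and> set xs \<subseteq> carrier G}"
    "hurwitz_move_inv G i xs \<in> {xs. length xs = k \<and> set xs \<subseteq> carrier G}"
    using xs i by (auto simp: hurwitz_move_split hurwitz_move_inv_split)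
qed auto

section \<open>Quasipositive factorizations\<close>

text \<open>The length of a factorization is not part of the definition: it equals \<open>braid_exponent Z\<close>, see
  \<open>qp_factorizations_length\<close>. Hence the braid group on that many strings is the one that acts.\<close>

definition qp_factorizations :: "braid \<Rightarrow> braid list set" where
  "qp_factorizations Z =
    {xs. foldr (monoid.mult (braid_group 3)) xs \<one>\<^bsub>braid_group 3\<^esub> = Z \<and>
      (\<forall>x\<in>set xs. \<exists>g\<in>carrier (braid_group 3).
         x = g \<otimes>\<^bsub>braid_group 3\<^esub> braid_gen 3 1 \<otimes>\<^bsub>braid_group 3\<^esub> inv\<^bsub>braid_group 3\<^esub> g)}"

lemma (in group) foldr_mult_closed:
  "set xs \<subseteq> carrier G \<Longrightarrow> y \<in> carrier G \<Longrightarrow> foldr (\<otimes>) xs y \<in> carrier G"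
  by (induction xs) auto

lemma (in group) conj_conj:
  assumes "a \<in> carrier G" "g \<in> carrier G" "s \<in> carrier G"
  shows "a \<otimes> (g \<otimes> s \<otimes> inv g) \<otimes> inv a = (a \<otimes> g) \<otimes> s \<otimes> inv (a \<otimes> g)"
  using assms by (simp add: m_assoc inv_mult_group)

lemma qp_factorizations_carrier:
  assumes "xs \<in> qp_factorizations Z"
  shows "set xs \<subseteq> carrier (braid_group 3)"
proof -
  interpret B: group "braid_group 3" by (rule group_braid_group)
  show ?thesis
    using assms braid_gen_carrier[of 1 3] by (force simp: qp_factorizations_def)
qed

lemma qp_factorizations_length:
  assumes "xs \<in> qp_factorizations Z"
  shows "int (length xs) = braid_exponent Z"
proof -
  interpret B: group "braid_group 3" by (rule group_braid_group)
  interpret e: group_hom "braid_group 3" integer_group braid_exponent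
    by (simp add: group_hom_def group_hom_axioms_def B.is_group braid_exponent_hom)
  let ?P = "\<lambda>x. \<exists>g\<in>carrier (braid_group 3).
         x = g \<otimes>\<^bsub>braid_group 3\<^esub> braid_gen 3 1 \<otimes>\<^bsub>braid_group 3\<^esub> inv\<^bsub>braid_group 3\<^esub> g"
  have s: "braid_gen 3 1 \<in> carrier (braid_group 3)" by (rule braid_gen_carrier) auto
  have one: "x \<in> carrier (braid_group 3) \<and> braid_exponent x = 1" if "?P x" for x
    using that s by (auto simp: braid_exponent_gen)
  have "braid_exponent (foldr (monoid.mult (braid_group 3)) xs \<one>\<^bsub>braid_group 3\<^esub>) = int (length xs)"
    if "\<forall>x\<in>set xs. ?P x"
    using that
  proof (induction xs)
    case (Cons x xs)
    have "foldr (monoid.mult (braid_group 3)) xs \<one>\<^bsub>braid_group 3\<^esub> \<in> carrier (braid_group 3)"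
      by (rule B.foldr_mult_closed) (use Cons.prems one in auto)
    moreover have "x \<in> carrier (braid_group 3) \<and> braid_exponent x = 1"
      by (rule one) (use Cons.prems in auto)
    ultimately show ?case using Cons by simp
  qed (use e.hom_one in simp)
  then show ?thesis using assms by (simp add: qp_factorizations_def)
qed

lemma hurwitz_set_qp_factorizations:
  "hurwitz_set (braid_group 3) (nat (braid_exponent Z)) (qp_factorizations Z)"
proof -
  interpret B: group "braid_group 3" by (rule group_braid_group)
  show ?thesis
  proof
    fix xs assume xs: "xs \<in> qp_factorizations Z"
    show "length xs = nat (braid_exponent Z) \<and> set xs \<subseteq> carrier (braid_group 3)"
      using qp_factorizations_length[OF xs] qp_factorizations_carrier[OF xs] by simp
    fix i assume i: "1 \<le> i" "i < nat (braid_exponent Z)"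
    then have "i < length xs" using qp_factorizations_length[OF xs] by auto
    then obtain us a b vs where split: "xs = us @ a # b # vs" "length us = i - 1"
      using list_split2 i(1) by metis
    have s: "braid_gen 3 1 \<in> carrier (braid_group 3)" by (rule braid_gen_carrier) auto
    have ab: "a \<in> carrier (braid_group 3)" "b \<in> carrier (braid_group 3)"
      "set vs \<subseteq> carrier (braid_group 3)"
      using qp_factorizations_carrier[OF xs] split(1) by auto
    define p where "p = foldr (monoid.mult (braid_group 3)) vs \<one>\<^bsub>braid_group 3\<^esub>"
    have p: "p \<in> carrier (braid_group 3)"
      unfolding p_def using ab by (intro B.foldr_mult_closed) auto
    obtain g h where gh: "g \<in> carrier (braid_group 3)" "h \<in> carrier (braid_group 3)"
      "a = g \<otimes>\<^bsub>braid_group 3\<^esub> braid_gen 3 1 \<otimes>\<^bsub>braid_group 3\<^esub> inv\<^bsub>braid_group 3\<^esub> g"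
      "b = h \<otimes>\<^bsub>braid_group 3\<^esub> braid_gen 3 1 \<otimes>\<^bsub>braid_group 3\<^esub> inv\<^bsub>braid_group 3\<^esub> h"
      using xs split(1) by (auto simp: qp_factorizations_def)
    have c1: "\<exists>g'\<in>carrier (braid_group 3).
      a \<otimes>\<^bsub>braid_group 3\<^esub> b \<otimes>\<^bsub>braid_group 3\<^esub> inv\<^bsub>braid_group 3\<^esub> a =
      g' \<otimes>\<^bsub>braid_group 3\<^esub> braid_gen 3 1 \<otimes>\<^bsub>braid_group 3\<^esub> inv\<^bsub>braid_group 3\<^esub> g'"
      using B.conj_conj[OF ab(1) gh(2) s] ab gh(2) unfolding gh(4) by blast
    have c2: "\<exists>g'\<in>carrier (braid_group 3).
      inv\<^bsub>braid_group 3\<^esub> b \<otimes>\<^bsub>braid_group 3\<^esub> a \<otimes>\<^bsub>braid_group 3\<^esub> b =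
      g' \<otimes>\<^bsub>braid_group 3\<^esub> braid_gen 3 1 \<otimes>\<^bsub>braid_group 3\<^esub> inv\<^bsub>braid_group 3\<^esub> g'"
      using B.conj_conj[OF B.inv_closed[OF ab(2)] gh(1) s] ab gh(1) B.inv_inv[OF ab(2)]
      unfolding gh(3) by (metis B.inv_closed B.m_closed)
    have q: "foldr (monoid.mult (braid_group 3)) (us @ x # y # vs) \<one>\<^bsub>braid_group 3\<^esub> =
       foldr (monoid.mult (braid_group 3)) us (x \<otimes>\<^bsub>braid_group 3\<^esub> y \<otimes>\<^bsub>braid_group 3\<^esub> p)"
      if "x \<in> carrier (braid_group 3)" "y \<in> carrier (braid_group 3)" for x y
      using that p by (simp add: p_def B.m_assoc)
    show "hurwitz_move (braid_group 3) i xs \<in> qp_factorizations Z"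
      using xs c1 ab B.conj_cancel(3)[OF ab(1,2)] i
      unfolding split(1) hurwitz_move_split[OF i(1) split(2)] qp_factorizations_def
      by (auto simp: q simp del: foldr_append foldr.simps)
    show "hurwitz_move_inv (braid_group 3) i xs \<in> qp_factorizations Z"
      using xs c2 ab B.conj_cancel(4)[OF ab(1,2)] i
      unfolding split(1) hurwitz_move_inv_split[OF i(1) split(2)] qp_factorizations_def
      by (auto simp: q simp del: foldr_append foldr.simps)
  qed
qed

lemma group_action_qp_factorizations:
  assumes "braid_exponent Z = int k"
  shows "group_action (braid_group k) (qp_factorizations Z)
    (hurwitz_action (braid_group 3) (qp_factorizations Z))"
  using hurwitz_set.group_action_hurwitz[OF hurwitz_set_qp_factorizations[of Z]] assms by simp

end

theory Submission
  imports Defs Complex_Main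
begin

text \<open>
  Write \<open>a = \<sigma>\<^sub>1\<close>, \<open>b = \<sigma>\<^sub>2\<inverse>\<close>, let \<open>D\<close> be the half-twist braid \<open>\<sigma>\<^sub>1\<sigma>\<^sub>2\<sigma>\<^sub>1\<close> and \<open>z = D\<^sup>2\<close>, which is
  central. Under the usual map to \<open>SL\<^sub>2(\<int>)\<close> the letters \<open>a\<close> and \<open>b\<close> become the upper and the lower
  unipotent matrix, so positive words in \<open>a, b\<close> multiply freely (\<open>ev_inj\<close>), while \<open>D\<close> inverts them up
  to reversal and exchange of letters: if \<open>V*\<close> denotes \<open>V\<close> reversed with \<open>a\<close> and \<open>b\<close> exchanged, then
  \<open>V D V* = D\<close>. Every braid is a central element times a positive word with perhaps a \<open>D\<close> at either
  end (\<open>normal_form\<close>).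

  Applied to the relative position of two conjugates of \<open>\<sigma>\<^sub>1\<close>, the normal form shows that, up to
  simultaneous conjugation, a factorization \<open>X = x y\<close> has one of three shapes
  (\<open>factor_standard\<close>): \<open>X = \<sigma>\<^sub>1\<^sup>2\<close>, or \<open>X = \<sigma>\<^sub>1\<sigma>\<^sub>2\<close>, or \<open>X = z P\<close> with the positive word
  \<open>P = bb V bb V*\<close> and \<open>x = bbD\<close>. The trace in \<open>SL\<^sub>2(\<int>)\<close> is \<open>2\<close>, \<open>1\<close> or at most \<open>-2\<close>
  respectively, so all factorizations of one braid have the same shape. In the first two cases the
  centralizer of \<open>X\<close> is small enough to leave a single orbit.

  In the third case, two factorizations of \<open>X\<close> give words \<open>P\<close> and \<open>P'\<close> that are conjugate in the
  group. Since the words are positive, they are cyclic rotations of each other, and the conjugating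
  element is a prefix of \<open>P P P \<dots>\<close> up to powers of \<open>P\<close> and central elements
  (\<open>positive_words_conjugate\<close>). Powers of \<open>P\<close> act as conjugation by \<open>X\<close>, which is the square of
  the Hurwitz move. So orbits are described by the positions \<open>r\<close> at which the
  cyclic word \<open>P\<close>, of length \<open>2N\<close>, reads \<open>bb V bb V*\<close>. The position \<open>r + N\<close> then has the same
  property, with \<open>V\<close> and \<open>V*\<close> exchanged, and passing to it is exactly one Hurwitz move
  (\<open>half_rotation\<close>). It remains to see that there are at most two such positions modulo \<open>N\<close>.

  Put \<open>+1\<close> for the letter \<open>b\<close> and \<open>-1\<close> for \<open>a\<close> at the points \<open>exp(2\<pi>ij/N)\<close>, and let \<open>A\<close> be the
  weighted sum of these points. A position \<open>r\<close> as above is an axis of reflection under which the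
  weights are antisymmetric, apart from the four letters \<open>b\<close> next to the axis. So the component of
  \<open>A\<close> along the direction of angle \<open>(2r+1)\<pi>/N\<close> comes from these four letters alone and equals
  \<open>4 cos(\<pi>/N)\<close> (\<open>antisymmetric_fourier\<close>). In other words, \<open>A\<close> lies on the tangent, at that angle,
  to the circle of radius \<open>4 cos(\<pi>/N)\<close>, and at most two tangents to a circle pass through one point.
  (For \<open>N = 2\<close> the radius vanishes, but there are only two residues modulo \<open>N\<close>.)
\<close>

section \<open>Antisymmetric axes of a cyclic word\<close>

text \<open>Dually, the line \<open>p x + q y = c\<close> meets the unit circle in at most two points: a point of the line
  other than a given one is obtained by moving along \<open>(- q, p)\<close>, and lying on the circle determines how
  far.\<close>

lemma tangent_lines:
  fixes p q c :: real
  assumes "c \<noteq> 0"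
    and "p * cos t1 + q * sin t1 = c" "p * cos t2 + q * sin t2 = c" "p * cos t3 + q * sin t3 = c"
  shows "cis t1 = cis t2 \<or> cis t1 = cis t3 \<or> cis t2 = cis t3"
proof (rule ccontr)
  assume no: "\<not> ?thesis"
  define x1 y1 x2 y2 x3 y3 where d: "x1 = cos t1" "y1 = sin t1" "x2 = cos t2" "y2 = sin t2"
    "x3 = cos t3" "y3 = sin t3"
  have u: "x1\<^sup>2 + y1\<^sup>2 = 1" "x2\<^sup>2 + y2\<^sup>2 = 1" "x3\<^sup>2 + y3\<^sup>2 = 1"
    by (simp_all add: d)
  have l: "p * x1 + q * y1 = c" "p * x2 + q * y2 = c" "p * x3 + q * y3 = c"
    using assms by (simp_all add: d)
  have two: "\<exists>k. x = x1 - k * q \<and> y = y1 + k * p \<and> k * (p\<^sup>2 + q\<^sup>2) = 2 * (x1 * q - y1 * p)"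
    if "x\<^sup>2 + y\<^sup>2 = 1" "p * x + q * y = c" "\<not> (x = x1 \<and> y = y1)" for x y
  proof -
    have n: "p\<^sup>2 + q\<^sup>2 \<noteq> 0" using assms(1,2) by (auto simp: sum_power2_eq_zero_iff)
    define k where "k = ((y - y1) * p - (x - x1) * q) / (p\<^sup>2 + q\<^sup>2)"
    have pq: "p * (x - x1) + q * (y - y1) = 0" using that(2) l(1) by (simp add: algebra_simps)
    have kk: "k * (p\<^sup>2 + q\<^sup>2) = (y - y1) * p - (x - x1) * q" using n by (simp add: k_def)
    have "(x - x1 + k * q) * (p\<^sup>2 + q\<^sup>2) = (x - x1) * (p\<^sup>2 + q\<^sup>2) + q * (k * (p\<^sup>2 + q\<^sup>2))"
      by (simp add: algebra_simps)
    also have "\<dots> = p * (p * (x - x1) + q * (y - y1))"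
      unfolding kk by (simp add: algebra_simps power2_eq_square)
    finally have "(x - x1 + k * q) * (p\<^sup>2 + q\<^sup>2) = 0" using pq by simp
    hence 1: "x = x1 - k * q" using n by (simp del: sum_power2_eq_zero_iff)
    have "(y - y1 - k * p) * (p\<^sup>2 + q\<^sup>2) = (y - y1) * (p\<^sup>2 + q\<^sup>2) - p * (k * (p\<^sup>2 + q\<^sup>2))"
      by (simp add: algebra_simps)
    also have "\<dots> = q * (p * (x - x1) + q * (y - y1))"
      unfolding kk by (simp add: algebra_simps power2_eq_square)
    finally have "(y - y1 - k * p) * (p\<^sup>2 + q\<^sup>2) = 0" using pq by simp
    hence 2: "y = y1 + k * p" using n by (simp del: sum_power2_eq_zero_iff)
    have "k * (k * (p\<^sup>2 + q\<^sup>2) - 2 * (x1 * q - y1 * p)) = 0"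
      using that(1) u(1) unfolding 1 2 by (simp add: algebra_simps power2_eq_square)
    moreover have "k \<noteq> 0" using 1 2 that(3) by auto
    ultimately show ?thesis using 1 2 by auto
  qed
  have "\<not> (x2 = x1 \<and> y2 = y1)" "\<not> (x3 = x1 \<and> y3 = y1)" "\<not> (x2 = x3 \<and> y2 = y3)"
    using no by (auto simp: d complex_eq_iff)
  moreover obtain k where k: "x2 = x1 - k * q" "y2 = y1 + k * p" "k * (p\<^sup>2 + q\<^sup>2) = 2 * (x1 * q - y1 * p)"
    using two[OF u(2) l(2)] calculation by auto
  moreover obtain k' where k': "x3 = x1 - k' * q" "y3 = y1 + k' * p" "k' * (p\<^sup>2 + q\<^sup>2) = 2 * (x1 * q - y1 * p)"
    using two[OF u(3) l(3)] calculation by auto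
  moreover have "p\<^sup>2 + q\<^sup>2 \<noteq> 0" using assms(1,2) by (auto simp: sum_power2_eq_zero_iff)
  ultimately have "k = k'" by (metis mult_right_cancel)
  then show False using k k' \<open>\<not> (x2 = x3 \<and> y2 = y3)\<close> by auto
qed

text \<open>The function \<open>s\<close> stands for a cyclic word of length \<open>2 * N\<close>, read from position \<open>r\<close>. The axis of the
  reflection \<open>r + i \<mapsto> r + 1 - i\<close> passes between the letters \<open>r\<close> and \<open>r + 1\<close> and, on the opposite side,
  between \<open>r + N\<close> and \<open>r + N + 1\<close>. These four letters are \<open>True\<close>, and all others change under the reflection.\<close>

definition antisymmetric_at :: "nat \<Rightarrow> (nat \<Rightarrow> bool) \<Rightarrow> nat \<Rightarrow> bool" where
  "antisymmetric_at N s r \<longleftrightarrow> s r \<and> s (r + 1) \<and> s (r + N) \<and> s (r + N + 1) \<and>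
     (\<forall>j<N - 2. s (r + 2 + j) \<noteq> s (r + 2 * N - 1 - j))"

lemma sum_periodic_shift:
  fixes h :: "nat \<Rightarrow> real"
  assumes per: "\<And>j. h (j + M) = h j"
  shows "(\<Sum>j<M. h (r + j)) = (\<Sum>j<M. h j)"
proof (induction r)
  case (Suc r)
  have "(\<Sum>j<M. h (Suc r + j)) + h r = (\<Sum>j<Suc M. h (r + j))"
    by (subst sum.lessThan_Suc_shift) simp
  also have "\<dots> = (\<Sum>j<M. h (r + j)) + h r" using per[of r] by simp
  finally show ?case using Suc by simp
qed simp

text \<open>The two sums are the real and imaginary part of \<open>A = \<Sum>j. e j * cis (2 * pi * j / N)\<close>. Projecting
  \<open>A\<close> to the direction \<open>t\<close> of the axis, two letters exchanged by the reflection have equal cosines and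
  opposite signs, so only the four letters next to the axis contribute.\<close>

lemma antisymmetric_fourier:
  fixes s :: "nat \<Rightarrow> bool"
  assumes N: "2 \<le> N" and per: "\<And>j. s (j + 2 * N) = s j" and r: "antisymmetric_at N s r"
  defines "e \<equiv> \<lambda>j. if s j then 1 else - 1 :: real"
  defines "t \<equiv> (2 * real r + 1) * pi / N"
  shows "(\<Sum>j<2*N. e j * cos (2 * pi * j / N)) * cos t + (\<Sum>j<2*N. e j * sin (2 * pi * j / N)) * sin t
    = 4 * cos (pi / N)"
proof -
  define h where "h j = e j * cos (2 * pi * j / N - t)" for j
  have perh: "h (j + 2 * N) = h j" for j
  proof -
    have "2 * pi * real (j + 2 * N) / N - t = (2 * pi * j / N - t + 2 * pi) + 2 * pi"
      using N by (simp add: field_simps)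
    then have "cos (2 * pi * real (j + 2 * N) / N - t) = cos (2 * pi * j / N - t)"
      by (simp only: cos_periodic)
    then show ?thesis unfolding h_def e_def using per by simp
  qed
  \<comment> \<open>Reading from position \<open>r\<close>, the letter number \<open>i\<close> makes the angle of \<open>i - 1/2\<close> steps with the axis.\<close>
  define k where "k i = cos (2 * pi * (real i - 1 / 2) / N)" for i :: nat
  have hk: "h (r + i) = e (r + i) * k i" for i
  proof -
    have "2 * pi * real (r + i) / N - t = 2 * pi * (real i - 1 / 2) / N"
      unfolding t_def using N by (simp add: field_simps)
    then show ?thesis by (simp add: h_def k_def)
  qed
  obtain M where M: "N = M + 2" using N by (metis add.commute le_Suc_ex)
  have split: "(\<Sum>i<2*N. q i) = q 0 + q 1 + (\<Sum>j<M. q (2 + j)) + q N + q (N + 1)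
      + (\<Sum>j<M. q (2 * N - 1 - j))" for q :: "nat \<Rightarrow> real"
  proof -
    have "(\<Sum>i<n + m. q i) = (\<Sum>i<n. q i) + (\<Sum>i<m. q (n + i))" for n m
      by (induction m) auto
    note add = this
    have "(\<Sum>i<2*N. q i) = (\<Sum>i<2 + M + 2 + M. q i)" using M by (simp add: add.assoc mult_2)
    also have "\<dots> = (\<Sum>i<2. q i) + (\<Sum>i<M. q (2 + i)) + (\<Sum>i<2. q (2 + M + i)) +
        (\<Sum>i<M. q (2 + M + 2 + i))"
      by (simp only: add)
    also have "(\<Sum>i<M. q (2 + M + 2 + i)) = (\<Sum>i<M. q (2 + M + 2 + (M - Suc i)))"
      by (rule sum.nat_diff_reindex[symmetric])
    also have "\<dots> = (\<Sum>i<M. q (2 * N - 1 - i))"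
      by (rule sum.cong) (auto simp: M intro!: arg_cong[of _ _ q])
    finally show ?thesis by (simp add: M numeral_2_eq_2 add_ac)
  qed
  have k0: "k 0 = cos (pi / N)" "k 1 = cos (pi / N)" "k N = cos (pi / N)" "k (N + 1) = cos (pi / N)"
  proof -
    have "2 * pi * (0 - 1 / 2) / N = - (pi / N)" "2 * pi * (1 - 1 / 2) / N = pi / N" by simp_all
    then show "k 0 = cos (pi / N)" "k 1 = cos (pi / N)"
      by (simp_all only: k_def of_nat_0 of_nat_1 cos_minus)
    have "2 * pi * (x - 1 / 2) / x = 2 * pi - pi / x"
      "2 * pi * (x + 1 - 1 / 2) / x = pi / x + 2 * pi" if "x \<noteq> 0" for x :: real
      using that by (simp_all add: divide_simps) (simp_all add: algebra_simps)
    from this[of "real N"] N have "2 * pi * (real N - 1 / 2) / N = 2 * pi - pi / N"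
      "2 * pi * (real (N + 1) - 1 / 2) / N = pi / N + 2 * pi" by simp_all
    then show "k N = cos (pi / N)" "k (N + 1) = cos (pi / N)"
      by (simp_all only: k_def cos_2pi_minus cos_periodic)
  qed
  have kk: "k (2 * N - 1 - j) = k (2 + j)" if "j < M" for j
  proof -
    have real: "real (2 * N - 1 - j) = 2 * real N - 1 - real j" using that M by (simp add: of_nat_diff)
    have "2 * pi * (2 * x - 1 - y - 1 / 2) / x = 2 * pi - 2 * pi * (2 + y - 1 / 2) / x + 2 * pi"
      if "x \<noteq> 0" for x y :: real
      using that by (simp add: divide_simps) (simp add: algebra_simps)
    from this[of "real N" "real j"] N
    have "2 * pi * (real (2 * N - 1 - j) - 1 / 2) / N = 2 * pi - 2 * pi * (real (2 + j) - 1 / 2) / N + 2 * pi"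
      unfolding real by simp
    then show ?thesis by (simp only: k_def cos_2pi_minus cos_periodic)
  qed
  have "(\<Sum>j<2*N. e j * cos (2 * pi * j / N)) * cos t + (\<Sum>j<2*N. e j * sin (2 * pi * j / N)) * sin t
      = (\<Sum>j<2*N. h j)"
    unfolding h_def cos_diff sum_distrib_right distrib_left sum.distrib by (simp only: mult.assoc)
  also have "\<dots> = (\<Sum>i<2*N. e (r + i) * k i)"
    using sum_periodic_shift[of h "2 * N" r, OF perh] unfolding hk by (simp only:)
  also have "\<dots> = 4 * cos (pi / N) + (\<Sum>j<M. e (r + (2 + j)) * k (2 + j)) +
      (\<Sum>j<M. e (r + (2 * N - 1 - j)) * k (2 * N - 1 - j))"
  proof -
    have "e (r + 0) = 1" "e (r + 1) = 1" "e (r + N) = 1" "e (r + (N + 1)) = 1"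
      using r by (simp_all add: e_def antisymmetric_at_def)
    then show ?thesis unfolding split k0 by simp
  qed
  also have "(\<Sum>j<M. e (r + (2 * N - 1 - j)) * k (2 * N - 1 - j)) = (\<Sum>j<M. - (e (r + (2 + j)) * k (2 + j)))"
  proof (rule sum.cong)
    fix j assume j: "j \<in> {..<M}"
    then have "s (r + 2 + j) \<noteq> s (r + 2 * N - 1 - j)" using r M by (simp add: antisymmetric_at_def)
    moreover have "r + 2 * N - 1 - j = r + (2 * N - 1 - j)" using j M by simp
    ultimately have "e (r + (2 * N - 1 - j)) = - e (r + (2 + j))" by (auto simp: e_def add.assoc)
    then show "e (r + (2 * N - 1 - j)) * k (2 * N - 1 - j) = - (e (r + (2 + j)) * k (2 + j))"
      using kk j by simp
  qed simp
  finally show ?thesis by (simp add: sum_negf)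
qed

lemma cis_eq_imp_cong:
  fixes N r r' :: nat
  assumes "0 < N" and "cis ((2 * real r + 1) * pi / N) = cis ((2 * real r' + 1) * pi / N)"
  shows "r mod N = r' mod N"
proof -
  have "cis ((2 * real r + 1) * pi / N - (2 * real r' + 1) * pi / N) = 1"
    using assms(2) by (simp flip: cis_divide)
  then have "cos ((2 * real r + 1) * pi / N - (2 * real r' + 1) * pi / N) = 1"
    by (simp add: complex_eq_iff)
  then obtain x :: int where "(2 * real r + 1) * pi / N - (2 * real r' + 1) * pi / N = real_of_int x * 2 * pi"
    unfolding cos_one_2pi_int by blast
  moreover have "(2 * real r + 1) * pi / N - (2 * real r' + 1) * pi / N = (real r - real r') * (2 * pi) / N"
    using assms(1) by (simp add: algebra_simps flip: diff_divide_distrib)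
  ultimately have "(real r - real r') / N * (2 * pi) = real_of_int x * (2 * pi)"
    by (simp only: times_divide_eq_left mult.assoc)
  then have "(real r - real r') / N = real_of_int x"
    using mult_right_cancel[of "2 * pi" "(real r - real r') / N" "real_of_int x"] pi_neq_zero by linarith
  then have "real r - real r' = real_of_int x * N" using assms(1) by (simp add: divide_simps)
  then have "real_of_int (int r - int r') = real_of_int (x * int N)" by simp
  then have "int r - int r' = x * int N" by (simp only: of_int_eq_iff)
  then have "int r mod int N = int r' mod int N" by (simp add: mod_eq_dvd_iff)
  then show ?thesis by (simp flip: zmod_int)
qed

text \<open>For \<open>N = 2\<close> the circle of radius \<open>4 * cos (pi / N)\<close> degenerates to a point and the tangents say
  nothing, but then there are only two residues.\<close>

lemma antisymmetric_at_most_two: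
  fixes s :: "nat \<Rightarrow> bool"
  assumes N: "2 \<le> N" and per: "\<And>j. s (j + 2 * N) = s j"
    and "antisymmetric_at N s r1" "antisymmetric_at N s r2" "antisymmetric_at N s r3"
  shows "r1 mod N = r2 mod N \<or> r1 mod N = r3 mod N \<or> r2 mod N = r3 mod N"
proof (cases "N = 2")
  case True
  then show ?thesis by simp presburger
next
  case False
  then have "real N > 2" using N by linarith
  then have "0 < pi / N" "pi / N < pi / 2"
    using divide_strict_left_mono[of 2 "real N" pi] by simp_all
  then have c: "4 * cos (pi / N) \<noteq> 0" using cos_gt_zero[of "pi / N"] by linarith
  have "0 < N" using N by linarith
  note eqs = cis_eq_imp_cong[OF this, of r1 r2] cis_eq_imp_cong[OF this, of r1 r3]
    cis_eq_imp_cong[OF this, of r2 r3]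
  from tangent_lines[OF c antisymmetric_fourier[OF N per assms(3)]
      antisymmetric_fourier[OF N per assms(4)] antisymmetric_fourier[OF N per assms(5)]]
  show ?thesis using eqs by argo
qed

section \<open>Words that are conjugate in the free monoid\<close>

text \<open>The equation makes \<open>T @ P'\<close> invariant under the shift by \<open>length P\<close>, so it is a prefix of the
  periodic word \<open>P @ P @ \<dots>\<close>; \<open>P'\<close> is then a cyclic rotation of \<open>P\<close>.\<close>

lemma conjugate_words_periodic:
  assumes "T @ P' = P @ T" "P \<noteq> []"
  shows "i < length T \<Longrightarrow> T ! i = P ! (i mod length P)"
    and "i < length P \<Longrightarrow> P' ! i = P ! ((length T + i) mod length P)"
proof -
  have len: "length P' = length P" using assms(1) by (metis add_left_cancel add.commute length_append)
  have *: "i < length P + length T \<Longrightarrow> (P @ T) ! i = P ! (i mod length P)" for i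
  proof (induction i rule: less_induct)
    case (less i)
    show ?case
    proof (cases "i < length P")
      case True then show ?thesis by (simp add: nth_append)
    next
      case False
      then have "(P @ T) ! i = T ! (i - length P)" by (simp add: nth_append)
      also have "\<dots> = (T @ P') ! (i - length P)"
        using False less.prems by (subst nth_append) (simp, linarith)
      also have "\<dots> = (P @ T) ! (i - length P)" using assms(1) by simp
      also have "\<dots> = P ! ((i - length P) mod length P)"
        by (rule less.IH) (use False assms(2) less.prems length_greater_0_conv[of P] in linarith)+
      also have "\<dots> = P ! (i mod length P)" using False by (simp add: le_mod_geq)
      finally show ?thesis .
    qed
  qed
  show "i < length T \<Longrightarrow> T ! i = P ! (i mod length P)"
    using *[of i] by (metis assms(1) nth_append trans_less_add2)
  show "i < length P \<Longrightarrow> P' ! i = P ! ((length T + i) mod length P)"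
    using *[of "length T + i"] by (metis add.commute assms(1) nat_add_left_cancel_less nth_append_length_plus)
qed

text \<open>With \<open>True\<close> for \<open>b\<close> and \<open>False\<close> for \<open>a\<close>, this is the operation \<open>V \<mapsto> V*\<close>: conjugation by \<open>D\<close> maps
  the inverse of \<open>V\<close> to it.\<close>

definition flip :: "bool list \<Rightarrow> bool list" where
  "flip w = rev (map Not w)"

lemma flip_simps [simp]:
  "flip [] = []" "flip (u @ v) = flip v @ flip u" "flip (x # v) = flip v @ [\<not> x]"
  "flip (flip w) = w" "length (flip w) = length w"
  by (simp_all add: flip_def rev_map comp_def)

lemma antisymmetric_at_word:
  assumes T: "T @ [True, True] @ V @ [True, True] @ flip V = P @ T"
    and N: "length V + 2 = N"
  shows "antisymmetric_at N (\<lambda>j. P ! (j mod (2 * N))) (length T)"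
proof -
  define P' where "P' = [True, True] @ V @ [True, True] @ flip V"
  have len: "length P = 2 * N" using arg_cong[OF T, of length] N by simp
  have ne: "P \<noteq> []" using len N by auto
  have *: "P ! ((length T + i) mod (2 * N)) = P' ! i" if "i < 2 * N" for i
    using conjugate_words_periodic(2)[of T P' P i] that T ne len by (simp add: P'_def)
  show ?thesis
    unfolding antisymmetric_at_def
  proof (intro conjI allI impI)
    show "P ! (length T mod (2 * N))" using *[of 0] N by (simp add: P'_def)
    show "P ! ((length T + 1) mod (2 * N))" using *[of 1] N by (simp add: P'_def)
    show "P ! ((length T + N) mod (2 * N))" using *[of N] N by (auto simp: P'_def nth_append simp flip: N)
    show "P ! ((length T + N + 1) mod (2 * N))"
      using *[of "N + 1"] N by (auto simp: P'_def nth_append add.assoc simp flip: N)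
    fix j assume j: "j < N - 2"
    have "length T + 2 * N - 1 - j = length T + (2 * N - 1 - j)" using j by simp
    moreover have "P' ! (2 + j) = V ! j" using j N by (auto simp: P'_def nth_append)
    moreover have "P' ! (2 * N - 1 - j) = (\<not> V ! j)"
    proof -
      have "P' ! (2 * N - 1 - j) = flip V ! (length V - 1 - j)"
        using j N by (auto simp: P'_def nth_append nth_Cons' simp flip: N)
      then show ?thesis using j N by (simp add: flip_def rev_nth)
    qed
    ultimately show "P ! ((length T + 2 + j) mod (2 * N)) \<noteq> P ! ((length T + 2 * N - 1 - j) mod (2 * N))"
      using *[of "2 + j"] *[of "2 * N - 1 - j"] j by (simp add: add.assoc)
  qed
qed

section \<open>Positive words and normal forms in a group of three-string braids\<close>

type_synonym mat2 = "int \<times> int \<times> int \<times> int"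

fun mat2_mult :: "mat2 \<Rightarrow> mat2 \<Rightarrow> mat2" where
  "mat2_mult (p, q, r, s) (p', q', r', s') =
    (p * p' + q * r', p * q' + q * s', r * p' + s * r', r * q' + s * s')"

fun mat2_trace :: "mat2 \<Rightarrow> int" where
  "mat2_trace (p, q, r, s) = p + s"

lemma mat2_mult_assoc: "mat2_mult (mat2_mult A B) C = mat2_mult A (mat2_mult B C)"
  by (cases A; cases B; cases C) (simp add: algebra_simps)

lemma mat2_trace_commute: "mat2_trace (mat2_mult A B) = mat2_trace (mat2_mult B A)"
  by (cases A; cases B) (simp add: algebra_simps)

text \<open>What the argument uses about the braid group on three strings: \<open>a = \<sigma>\<^sub>1\<close>, \<open>b = \<sigma>\<^sub>2\<inverse>\<close> and the half-twist
  \<open>D = \<sigma>\<^sub>1\<sigma>\<^sub>2\<sigma>\<^sub>1\<close> with the braid relation in the form that moves \<open>D\<close> past letters, and a homomorphism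
  \<open>\<rho>\<close> to integer matrices, which separates positive words.\<close>

locale three_strings = group G for G :: "('g, 'm) monoid_scheme" (structure) +
  fixes a b D :: 'g and \<rho> :: "'g \<Rightarrow> mat2"
  assumes carrier [simp]: "a \<in> carrier G" "b \<in> carrier G" "D \<in> carrier G"
    and generated: "carrier G = generate G {a, b}"
    and bDa: "b \<otimes> D \<otimes> a = D" and aDb: "a \<otimes> D \<otimes> b = D" and bDb: "b \<otimes> D \<otimes> b = a"
    and rho_one: "\<rho> \<one> = (1, 0, 0, 1)"
    and rho_mult: "x \<in> carrier G \<Longrightarrow> y \<in> carrier G \<Longrightarrow> \<rho> (x \<otimes> y) = mat2_mult (\<rho> x) (\<rho> y)"
    and rho_a: "\<rho> a = (1, 1, 0, 1)" and rho_b: "\<rho> b = (1, 0, 1, 1)"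
begin

lemma cancel_simps [simp]:
  assumes "x \<in> carrier G" "y \<in> carrier G"
  shows "inv x \<otimes> (x \<otimes> y) = y" "x \<otimes> (inv x \<otimes> y) = y"
  using assms by (simp_all flip: m_assoc)

lemmas group_simps = m_assoc inv_mult_group

definition conj_by :: "'g \<Rightarrow> 'g \<Rightarrow> 'g" where
  "conj_by g x = g \<otimes> x \<otimes> inv g"

lemma conj_by_closed [simp]: "g \<in> carrier G \<Longrightarrow> x \<in> carrier G \<Longrightarrow> conj_by g x \<in> carrier G"
  by (simp add: conj_by_def)

lemma conj_by_conj_by: "g \<in> carrier G \<Longrightarrow> h \<in> carrier G \<Longrightarrow> x \<in> carrier G \<Longrightarrow>
    conj_by g (conj_by h x) = conj_by (g \<otimes> h) x"
  by (simp add: conj_by_def group_simps)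

lemma conj_by_mult: "g \<in> carrier G \<Longrightarrow> x \<in> carrier G \<Longrightarrow> y \<in> carrier G \<Longrightarrow>
    conj_by g (x \<otimes> y) = conj_by g x \<otimes> conj_by g y"
  by (simp add: conj_by_def group_simps)

lemma conj_by_one [simp]: "x \<in> carrier G \<Longrightarrow> conj_by \<one> x = x"
  by (simp add: conj_by_def)

lemma conj_by_fixes_iff: "g \<in> carrier G \<Longrightarrow> x \<in> carrier G \<Longrightarrow> y \<in> carrier G \<Longrightarrow>
    conj_by g x = y \<longleftrightarrow> g \<otimes> x = y \<otimes> g"
  unfolding conj_by_def by (metis inv_solve_right' m_closed)

text \<open>Central factors disappear from all conjugations, so computations are done up to such factors
  without keeping track of which power of \<open>D \<otimes> D\<close> they are.\<close>

definition center :: "'g set" where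
  "center = {c \<in> carrier G. \<forall>x\<in>carrier G. x \<otimes> c = c \<otimes> x}"

lemma center_carrier [simp]: "c \<in> center \<Longrightarrow> c \<in> carrier G"
  by (simp add: center_def)

lemma center_commute: "c \<in> center \<Longrightarrow> x \<in> carrier G \<Longrightarrow> x \<otimes> c = c \<otimes> x"
  unfolding center_def by blast

lemma center_left_commute: "c \<in> center \<Longrightarrow> x \<in> carrier G \<Longrightarrow> y \<in> carrier G \<Longrightarrow>
    x \<otimes> (c \<otimes> y) = c \<otimes> (x \<otimes> y)"
  using center_commute[of c x] by (simp flip: m_assoc)

lemma center_one [simp]: "\<one> \<in> center"
  unfolding center_def by simp

lemma center_mult [simp]:
  assumes "c \<in> center" "d \<in> center"
  shows "c \<otimes> d \<in> center"
proof -
  have "x \<otimes> (c \<otimes> d) = c \<otimes> d \<otimes> x" if "x \<in> carrier G" for x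
  proof -
    have "x \<otimes> (c \<otimes> d) = c \<otimes> (x \<otimes> d)" using assms that by (simp only: center_left_commute center_carrier)
    also have "\<dots> = c \<otimes> d \<otimes> x" using assms that center_commute[OF assms(2) that] by (simp add: m_assoc)
    finally show ?thesis .
  qed
  moreover have "c \<otimes> d \<in> carrier G" using assms by simp
  ultimately show ?thesis unfolding center_def by blast
qed

lemma center_inv [simp]:
  assumes "c \<in> center"
  shows "inv c \<in> center"
proof -
  have "x \<otimes> inv c = inv c \<otimes> x" if "x \<in> carrier G" for x
  proof -
    have "inv c \<otimes> (x \<otimes> c) \<otimes> inv c = inv c \<otimes> (c \<otimes> x) \<otimes> inv c"
      by (simp only: center_commute[OF assms that])
    then show ?thesis using assms that by (simp add: m_assoc)
  qed
  moreover have "inv c \<in> carrier G" using assms by simp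
  ultimately show ?thesis unfolding center_def by blast
qed

lemma conj_by_center: "c \<in> center \<Longrightarrow> x \<in> carrier G \<Longrightarrow> conj_by c x = x"
  by (simp add: conj_by_fixes_iff center_commute)

lemma conj_by_center_self: "c \<in> center \<Longrightarrow> g \<in> carrier G \<Longrightarrow> conj_by g c = c"
  by (simp add: conj_by_fixes_iff center_commute)

lemma conj_by_center_mult: "c \<in> center \<Longrightarrow> g \<in> carrier G \<Longrightarrow> x \<in> carrier G \<Longrightarrow> conj_by (c \<otimes> g) x = conj_by g x"
  by (simp add: conj_by_center flip: conj_by_conj_by)

lemma conj_by_center_arg: "c \<in> center \<Longrightarrow> g \<in> carrier G \<Longrightarrow> x \<in> carrier G \<Longrightarrow>
    conj_by g (c \<otimes> x) = c \<otimes> conj_by g x"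
  by (simp add: conj_by_mult conj_by_center_self)

lemma commute_generators_imp_center:
  assumes "x \<in> carrier G" "x \<otimes> a = a \<otimes> x" "x \<otimes> b = b \<otimes> x"
  shows "x \<in> center"
proof -
  have "y \<in> carrier G \<and> x \<otimes> y = y \<otimes> x" if "y \<in> generate G {a, b}" for y
    using that
  proof (induction rule: generate.induct)
    case one then show ?case using assms(1) by simp
  next
    case (incl h) then show ?case using assms by auto
  next
    case (inv h)
    then have h: "h \<in> carrier G" "x \<otimes> h = h \<otimes> x" using assms by auto
    have "inv h \<otimes> (x \<otimes> h) \<otimes> inv h = inv h \<otimes> (h \<otimes> x) \<otimes> inv h" by (simp only: h(2))
    then show ?case using assms(1) h(1) by (simp add: m_assoc)
  next
    case (eng h1 h2)
    then have h: "h1 \<in> carrier G" "h2 \<in> carrier G" "x \<otimes> h1 = h1 \<otimes> x" "x \<otimes> h2 = h2 \<otimes> x" by auto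
    have "x \<otimes> (h1 \<otimes> h2) = (x \<otimes> h1) \<otimes> h2" using h(1,2) assms(1) by (simp add: m_assoc)
    also have "\<dots> = h1 \<otimes> (x \<otimes> h2)" unfolding h(3) using h(1,2) assms(1) by (simp add: m_assoc)
    also have "\<dots> = h1 \<otimes> h2 \<otimes> x" unfolding h(4) using h(1,2) assms(1) by (simp add: m_assoc)
    finally show ?case using h by simp
  qed
  then have "y \<otimes> x = x \<otimes> y" if "y \<in> carrier G" for y
    using that generated by metis
  then show ?thesis using assms(1) unfolding center_def by blast
qed

abbreviation z :: 'g where "z \<equiv> D \<otimes> D"

lemma D_moves: "D \<otimes> a = inv b \<otimes> D" "D \<otimes> b = inv a \<otimes> D" "a \<otimes> D = D \<otimes> inv b" "b \<otimes> D = D \<otimes> inv a"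
  using bDa aDb by (simp_all add: inv_solve_left inv_solve_right m_assoc)

lemma z_center [simp]: "z \<in> center"
proof (rule commute_generators_imp_center)
  have "z \<otimes> a = D \<otimes> (inv b \<otimes> D)" by (simp add: m_assoc D_moves(1))
  also have "\<dots> = a \<otimes> z" by (simp add: D_moves(3) flip: m_assoc)
  finally show "z \<otimes> a = a \<otimes> z" .
  have "z \<otimes> b = D \<otimes> (inv a \<otimes> D)" by (simp add: m_assoc D_moves(2))
  also have "\<dots> = b \<otimes> z" by (simp add: D_moves(4) flip: m_assoc)
  finally show "z \<otimes> b = b \<otimes> z" .
qed simp

lemma aDa: "a \<otimes> D \<otimes> a = z \<otimes> b"
proof -
  have "inv b \<otimes> a = D \<otimes> b" using bDb by (simp add: inv_solve_left' m_assoc)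
  then show ?thesis by (simp add: D_moves(3) m_assoc)
qed

definition letter :: "bool \<Rightarrow> 'g" where
  "letter l = (if l then b else a)"

definition ev :: "bool list \<Rightarrow> 'g" where
  "ev w = foldr (\<lambda>l x. letter l \<otimes> x) w \<one>"

lemma letter_carrier [simp]: "letter l \<in> carrier G"
  by (simp add: letter_def)

lemma ev_carrier [simp]: "ev w \<in> carrier G"
  by (induction w) (simp_all add: ev_def)

lemma ev_simps [simp]: "ev [] = \<one>" "ev (l # w) = letter l \<otimes> ev w"
  by (simp_all add: ev_def)

lemma ev_append [simp]: "ev (u @ v) = ev u \<otimes> ev v"
  by (induction u) (simp_all add: m_assoc)

lemma letter_D_Not: "letter l \<otimes> (D \<otimes> letter (\<not> l)) = D"
  using bDa aDb by (simp add: letter_def m_assoc)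

lemma ev_D_flip: "ev w \<otimes> (D \<otimes> ev (flip w)) = D"
proof (induction w)
  case (Cons l w)
  have "ev (l # w) \<otimes> (D \<otimes> ev (flip (l # w))) =
      letter l \<otimes> ((ev w \<otimes> (D \<otimes> ev (flip w))) \<otimes> letter (\<not> l))"
    by (simp add: m_assoc)
  then show ?case by (simp only: Cons.IH letter_D_Not)
qed simp

lemma D_ev: "D \<otimes> ev w = inv (ev (flip w)) \<otimes> D"
  using ev_D_flip[of "flip w"] by (simp add: inv_solve_left)

lemma ev_D: "ev w \<otimes> D = D \<otimes> inv (ev (flip w))"
  using ev_D_flip[of w] by (simp add: inv_solve_right m_assoc)

lemma D_ev_D: "D \<otimes> (ev w \<otimes> D) = z \<otimes> inv (ev (flip w))"
  by (simp add: ev_D m_assoc)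

text \<open>This is the normal form in \<open>PSL\<^sub>2(\<int>) = \<int>\<^sub>2 * \<int>\<^sub>3\<close>: positive words in \<open>a\<close> and \<open>b\<close> alternate between the
  two free factors, and \<open>D\<close> generates the factor of order two.\<close>

definition normal_form :: "'g \<Rightarrow> bool" where
  "normal_form h \<longleftrightarrow> (\<exists>c\<in>center. \<exists>w. \<exists>x\<in>{\<one>, D}. \<exists>y\<in>{\<one>, D}. h = c \<otimes> (x \<otimes> (ev w \<otimes> y)))"

lemma normal_formI:
  "c \<in> center \<Longrightarrow> x \<in> {\<one>, D} \<Longrightarrow> y \<in> {\<one>, D} \<Longrightarrow> normal_form (c \<otimes> (x \<otimes> (ev w \<otimes> y)))"
  unfolding normal_form_def by blast

lemma normal_form_center:
  assumes "c \<in> center" "normal_form h"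
  shows "normal_form (c \<otimes> h)"
proof -
  obtain d w x y where h: "d \<in> center" "x \<in> {\<one>, D}" "y \<in> {\<one>, D}" "h = d \<otimes> (x \<otimes> (ev w \<otimes> y))"
    using assms unfolding normal_form_def by blast
  have "c \<otimes> h = (c \<otimes> d) \<otimes> (x \<otimes> (ev w \<otimes> y))"
    using assms(1) h(1-3) unfolding h(4) by (auto simp: m_assoc)
  then show ?thesis using normal_formI[of "c \<otimes> d" x y w] assms(1) h by simp
qed

lemma normal_form_D:
  assumes "normal_form h"
  shows "normal_form (D \<otimes> h)"
proof -
  obtain c w x y where h: "c \<in> center" "x \<in> {\<one>, D}" "y \<in> {\<one>, D}" "h = c \<otimes> (x \<otimes> (ev w \<otimes> y))"
    using assms unfolding normal_form_def by blast
  have y: "y \<in> carrier G" using h by auto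
  show ?thesis
  proof (cases "x = \<one>")
    case True
    then have "D \<otimes> h = c \<otimes> (D \<otimes> (ev w \<otimes> y))"
      using h(1) y center_left_commute[of c D] by (simp add: h(4))
    then show ?thesis using normal_formI[of c D y] h by simp
  next
    case False
    then have "D \<otimes> h = (c \<otimes> z) \<otimes> (\<one> \<otimes> (ev w \<otimes> y))"
      using h(1,2) y center_left_commute[of c D] by (simp add: h(4) m_assoc)
    then show ?thesis using normal_formI[of "c \<otimes> z" \<one> y] h by simp
  qed
qed

lemma normal_form_letter:
  assumes "normal_form h"
  shows "normal_form (letter l \<otimes> h)"
proof -
  obtain c w x y where h: "c \<in> center" "x \<in> {\<one>, D}" "y \<in> {\<one>, D}" "h = c \<otimes> (x \<otimes> (ev w \<otimes> y))"
    using assms unfolding normal_form_def by blast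
  have xy: "x \<in> carrier G" "y \<in> carrier G" using h by auto
  have lh: "letter l \<otimes> h = c \<otimes> (letter l \<otimes> (x \<otimes> (ev w \<otimes> y)))"
    using h(1) xy center_left_commute[of c "letter l"] by (simp add: h(4))
  have "normal_form (letter l \<otimes> (x \<otimes> (ev w \<otimes> y)))"
  proof (cases "x = \<one>")
    case True
    then show ?thesis using normal_formI[of \<one> \<one> y "l # w"] h(3) xy by (simp add: m_assoc)
  next
    case False
    then have x: "x = D" using h(2) by simp
    show ?thesis
    proof (cases w)
      case Nil
      show ?thesis
      proof (cases "y = \<one>")
        case True
        then show ?thesis using normal_formI[of \<one> \<one> D "[l]"] by (simp add: x Nil m_assoc)
      next
        case False
        then have "letter l \<otimes> (x \<otimes> (ev w \<otimes> y)) = z \<otimes> letter l"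
          using h(3) center_commute[of z "letter l"] by (simp add: x Nil)
        then show ?thesis using normal_formI[of z \<one> \<one> "[l]"] by (simp add: m_assoc)
      qed
    next
      case (Cons m v)
      show ?thesis
      proof (cases "m = l")
        case True
        have "\<exists>c\<in>center. letter l \<otimes> D \<otimes> letter l = c \<otimes> letter (\<not> l)"
          using aDa bDb by (auto simp: letter_def intro: bexI[of _ z] bexI[of _ \<one>])
        then obtain d where d: "d \<in> center" "letter l \<otimes> D \<otimes> letter l = d \<otimes> letter (\<not> l)" by blast
        have "letter l \<otimes> (x \<otimes> (ev w \<otimes> y)) = (letter l \<otimes> D \<otimes> letter l) \<otimes> (ev v \<otimes> y)"
          using xy True by (simp add: x Cons m_assoc)
        also have "\<dots> = d \<otimes> (\<one> \<otimes> (ev ((\<not> l) # v) \<otimes> y))"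
          unfolding d(2) using d(1) xy by (simp add: m_assoc)
        finally have eq: "letter l \<otimes> (x \<otimes> (ev w \<otimes> y)) = d \<otimes> (\<one> \<otimes> (ev ((\<not> l) # v) \<otimes> y))" .
        show ?thesis unfolding eq using d(1) h(3) by (intro normal_formI) auto
      next
        case False
        then have m: "m = (\<not> l)" by simp
        have "letter l \<otimes> (x \<otimes> (ev w \<otimes> y)) = (letter l \<otimes> (D \<otimes> letter (\<not> l))) \<otimes> (ev v \<otimes> y)"
          using xy by (simp add: x Cons m m_assoc)
        then show ?thesis unfolding letter_D_Not using normal_formI[of \<one> D y v] h(3) xy by simp
      qed
    qed
  qed
  then show ?thesis unfolding lh using h(1) by (rule normal_form_center[rotated])
qed

text \<open>Left multiplication by the generators and their inverses preserves normal forms; for the inverses,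
  \<open>inv a\<close> is \<open>D \<otimes> b \<otimes> D\<close> up to a central factor, and \<open>inv b\<close> is \<open>D \<otimes> a \<otimes> D\<close>.\<close>

lemma normal_form:
  assumes "h \<in> carrier G"
  shows "normal_form h"
proof -
  have inv: "inv a = inv z \<otimes> (D \<otimes> (b \<otimes> D))" "inv b = inv z \<otimes> (D \<otimes> (a \<otimes> D))"
    by (simp_all add: D_moves(3,4) m_assoc inv_mult_group)
  have inv_letter: "normal_form (inv (letter l) \<otimes> x)" if "normal_form x" "x \<in> carrier G" for l x
  proof -
    have "inv (letter l) \<otimes> x = inv z \<otimes> (D \<otimes> (letter (\<not> l) \<otimes> (D \<otimes> x)))"
      using that by (simp add: letter_def inv m_assoc del: inv_mult_group)
    then show ?thesis
      using that normal_form_center[of "inv z"] normal_form_D normal_form_letter by simp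
  qed
  have *: "g \<in> carrier G \<and> (\<forall>x\<in>carrier G. normal_form x \<longrightarrow> normal_form (g \<otimes> x))"
    if "g \<in> generate G {a, b}" for g
    using that
  proof (induction rule: generate.induct)
    case (incl g)
    then show ?case using normal_form_letter[of _ True] normal_form_letter[of _ False]
      by (auto simp: letter_def)
  next
    case (inv g)
    then show ?case using inv_letter[of _ True] inv_letter[of _ False]
      by (auto simp: letter_def)
  next
    case (eng g1 g2)
    then show ?case by (simp add: m_assoc)
  qed simp
  have "normal_form \<one>" using normal_formI[of \<one> \<one> \<one> "[]"] by simp
  moreover have "h \<in> generate G {a, b}" using assms generated by simp
  ultimately have "normal_form (h \<otimes> \<one>)" using *[of h] by blast
  then show ?thesis using assms by simp
qed

lemma rho_letter: "\<rho> (letter l) = (if l then (1, 0, 1, 1) else (1, 1, 0, 1))"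
  by (simp add: letter_def rho_a rho_b)

lemma rho_D: "\<rho> D = (0, 1, - 1, 0)"
proof -
  obtain p q r s where rho: "\<rho> D = (p, q, r, s)" by (metis prod_cases4)
  have "\<rho> (b \<otimes> D \<otimes> b) = \<rho> a" by (simp only: bDb)
  then show ?thesis by (simp add: rho_mult rho_a rho_b rho)
qed

lemma rho_inv_b: "\<rho> (inv b) = (1, 0, - 1, 1)"
proof -
  obtain p q r s where rho: "\<rho> (inv b) = (p, q, r, s)" by (metis prod_cases4)
  have "\<rho> (b \<otimes> inv b) = \<rho> \<one>" by simp
  then show ?thesis unfolding rho_mult[OF carrier(2) inv_closed[OF carrier(2)]] by (auto simp: rho_one rho_b rho)
qed

definition trace :: "'g \<Rightarrow> int" where
  "trace x = mat2_trace (\<rho> x)"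

lemma trace_conj_by:
  assumes "g \<in> carrier G" "x \<in> carrier G"
  shows "trace (conj_by g x) = trace x"
proof -
  have "trace (conj_by g x) = mat2_trace (mat2_mult (\<rho> (g \<otimes> x)) (\<rho> (inv g)))"
    using assms by (simp add: trace_def conj_by_def rho_mult)
  also have "\<dots> = trace (inv g \<otimes> (g \<otimes> x))"
    using assms unfolding trace_def by (subst mat2_trace_commute, subst rho_mult) auto
  finally show ?thesis using assms by simp
qed

lemma rho_ev:
  obtains p q r s where "\<rho> (ev w) = (p, q, r, s)" "1 \<le> p" "0 \<le> q" "0 \<le> r" "1 \<le> s"
proof (induction w arbitrary: thesis)
  case Nil
  then show ?case by (simp add: rho_one)
next
  case (Cons l w)
  obtain p q r s where *: "\<rho> (ev w) = (p, q, r, s)" "1 \<le> p" "0 \<le> q" "0 \<le> r" "1 \<le> s"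
    using Cons.IH by metis
  show ?case
  proof (cases l)
    case True
    then show ?thesis using Cons.prems[of p q "p + r" "q + s"] * by (simp add: rho_mult rho_letter)
  next
    case False
    then show ?thesis using Cons.prems[of "p + r" "q + s" r s] * by (simp add: rho_mult rho_letter)
  qed
qed

text \<open>The difference of the two row sums; its sign reveals the first letter of a positive word, since
  \<open>a\<close> adds the lower row to the upper one and \<open>b\<close> the upper row to the lower one.\<close>

definition slope :: "'g \<Rightarrow> int" where
  "slope x = (case \<rho> x of (p, q, r, s) \<Rightarrow> p + q - r - s)"

lemma slope_ev_Nil: "slope (ev []) = 0"
  by (simp add: slope_def rho_one)

lemma slope_ev_Cons: "slope (ev (l # w)) < 0 \<longleftrightarrow> l" "0 < slope (ev (l # w)) \<longleftrightarrow> \<not> l"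
proof -
  obtain p q r s where "\<rho> (ev w) = (p, q, r, s)" "1 \<le> p" "0 \<le> q" "0 \<le> r" "1 \<le> s"
    by (rule rho_ev)
  then show "slope (ev (l # w)) < 0 \<longleftrightarrow> l" "0 < slope (ev (l # w)) \<longleftrightarrow> \<not> l"
    by (simp_all add: slope_def rho_mult rho_letter)
qed

lemma slope_ev_eq_0: "slope (ev w) = 0 \<Longrightarrow> w = []"
  using slope_ev_Cons[of "hd w" "tl w"] by (cases w) (simp, cases "hd w", simp_all)

lemma ev_inj: "ev u = ev v \<Longrightarrow> u = v"
proof (induction u arbitrary: v)
  case Nil
  have "slope (ev v) = 0" using slope_ev_Nil unfolding Nil .
  then show ?case using slope_ev_eq_0 by blast
next
  case (Cons l u)
  show ?case
  proof (cases v)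
    case Nil
    have "slope (ev (l # u)) = 0" using slope_ev_Nil unfolding Cons.prems Nil .
    then show ?thesis using slope_ev_eq_0 by blast
  next
    case v: (Cons m v')
    have eq: "ev (l # u) = ev (m # v')" using Cons.prems v by simp
    have "m = l"
      using slope_ev_Cons(1)[of l u] slope_ev_Cons(1)[of m v'] unfolding eq by blast
    then show ?thesis using eq Cons.IH[of v'] v by simp
  qed
qed

text \<open>The four shapes of the normal form of \<open>h\<close>: if \<open>D\<close> occurs once, moving it across \<open>P\<close> inverts \<open>P\<close>, and the
  equation becomes one of positive words with a longer word on one side. If \<open>D\<close> does not occur, the
  equation already is one between positive words. If it occurs twice, \<open>h\<close> is the inverse of a positive
  word \<open>W\<close> up to a central factor; \<open>W\<close> is a suffix of a power of \<open>P\<close>, and multiplying \<open>h\<close> by that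
  power makes it positive.\<close>

lemma positive_words_conjugate:
  assumes h: "h \<in> carrier G" and eq: "h \<otimes> ev P' = ev P \<otimes> h" and "P \<noteq> []"
  shows "\<exists>k T. \<exists>c\<in>center. ev P [^] (k::nat) \<otimes> h = c \<otimes> ev T \<and> T @ P' = P @ T"
proof -
  obtain c U x y where nf: "c \<in> center" "x \<in> {\<one>, D}" "y \<in> {\<one>, D}" "h = c \<otimes> (x \<otimes> (ev U \<otimes> y))"
    using normal_form[OF h] unfolding normal_form_def by blast
  have xy: "x \<in> carrier G" "y \<in> carrier G" using nf by auto
  define k where "k = x \<otimes> (ev U \<otimes> y)"
  have k: "k \<in> carrier G" using xy by (simp add: k_def)
  have "c \<otimes> (k \<otimes> ev P') = c \<otimes> (ev P \<otimes> k)"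
    using eq nf(1) k center_left_commute[of c "ev P" k] unfolding nf(4) k_def[symmetric] by (simp add: m_assoc)
  then have keq: "k \<otimes> ev P' = ev P \<otimes> k" using nf(1) k by simp
  have long: False if "ev U = ev (A @ U @ B)" "A \<noteq> [] \<or> B \<noteq> []" for A B
  proof -
    have "length U = length (A @ U @ B)" using ev_inj[OF that(1)] by (rule arg_cong)
    then show False using that(2) by simp
  qed
  consider "x = \<one>" "y = \<one>" | "x = D" "y = \<one>" | "x = \<one>" "y = D" | "x = D" "y = D"
    using nf by auto
  then show ?thesis
  proof cases
    case 1
    then have "ev (U @ P') = ev (P @ U)" using keq by (simp add: k_def)
    then have "U @ P' = P @ U" by (rule ev_inj)
    then show ?thesis using nf(1) h 1 by (intro exI[of _ 0] exI[of _ U] bexI[of _ c]) (auto simp: nf(4))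
  next
    case 2
    have "D \<otimes> (ev U \<otimes> ev P') = (ev P \<otimes> D) \<otimes> ev U"
      using keq 2 by (simp add: k_def m_assoc)
    also have "\<dots> = D \<otimes> (inv (ev (flip P)) \<otimes> ev U)" by (simp add: ev_D m_assoc)
    finally have "ev U \<otimes> ev P' = inv (ev (flip P)) \<otimes> ev U" by simp
    then have "ev (flip P) \<otimes> (ev U \<otimes> ev P') = ev U" by simp
    then have "ev U = ev (flip P @ U @ P')" by simp
    moreover have "flip P \<noteq> []" using \<open>P \<noteq> []\<close> by (simp add: flip_def)
    ultimately show ?thesis using long by blast
  next
    case 3
    have "ev U \<otimes> (D \<otimes> ev P') = ev P \<otimes> (ev U \<otimes> D)"
      using keq 3 by (simp add: k_def m_assoc)
    then have "(ev U \<otimes> inv (ev (flip P'))) \<otimes> D = (ev P \<otimes> ev U) \<otimes> D" by (simp add: D_ev m_assoc)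
    then have "ev U \<otimes> inv (ev (flip P')) = ev P \<otimes> ev U" by simp
    then have "ev U = ev P \<otimes> ev U \<otimes> ev (flip P')" by (simp add: inv_solve_right')
    then have "ev U = ev (P @ U @ flip P')" by (simp add: m_assoc)
    then show ?thesis using long \<open>P \<noteq> []\<close> by blast
  next
    case 4
    define W where "W = flip U"
    have kz: "k = z \<otimes> inv (ev W)" by (simp add: k_def 4 D_ev_D W_def)
    have "z \<otimes> (inv (ev W) \<otimes> ev P') = z \<otimes> (ev P \<otimes> inv (ev W))"
      using keq center_left_commute[of z "ev P" "inv (ev W)"] unfolding kz by (simp add: m_assoc)
    then have Weq: "inv (ev W) \<otimes> ev P' = ev P \<otimes> inv (ev W)" by simp
    then have "ev P' \<otimes> ev W = ev W \<otimes> ev P" by (simp add: inv_solve_left' inv_solve_right m_assoc)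
    then have "P' @ W = W @ P" using ev_inj[of "P' @ W" "W @ P"] by simp
    then have "\<exists>k T. ev P [^] (k::nat) = ev T \<otimes> ev W"
    proof (induction "length W" arbitrary: W rule: less_induct)
      case less
      then consider us where "P' = W @ us" "us @ W = P" | us where "P' @ us = W" "W = us @ P"
        by (auto simp: append_eq_append_conv2)
      then show ?case
      proof cases
        case 1
        then show ?thesis by (intro exI[of _ 1] exI[of _ us]) (auto simp flip: ev_append)
      next
        case 2
        then have "length us < length W" "P' @ us = us @ P" using \<open>P \<noteq> []\<close> by auto
        then obtain k T where "ev P [^] (k::nat) = ev T \<otimes> ev us" using less.hyps by blast
        then show ?thesis by (intro exI[of _ "Suc k"] exI[of _ T]) (simp add: 2(2) m_assoc)
      qed
    qed
    then obtain n T where T: "ev P [^] (n::nat) = ev T \<otimes> ev W" by blast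
    have "ev P [^] n \<otimes> h = c \<otimes> (ev P [^] n \<otimes> (z \<otimes> inv (ev W)))"
      unfolding nf(4) k_def[symmetric] kz using nf(1) by (simp add: center_left_commute)
    also have "\<dots> = c \<otimes> (z \<otimes> (ev P [^] n \<otimes> inv (ev W)))"
      by (simp only: center_left_commute z_center nat_pow_closed ev_carrier inv_closed)
    also have "ev P [^] n \<otimes> inv (ev W) = ev T" unfolding T by (simp add: m_assoc)
    finally have 1: "ev P [^] n \<otimes> h = (c \<otimes> z) \<otimes> ev T" using nf(1) by (simp add: m_assoc)
    have "ev T \<otimes> ev P' = ev P [^] n \<otimes> (inv (ev W) \<otimes> ev P')"
      unfolding T by (simp add: m_assoc)
    also have "\<dots> = (ev P [^] n \<otimes> ev P) \<otimes> inv (ev W)" unfolding Weq by (simp add: m_assoc)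
    also have "\<dots> = (ev P \<otimes> ev P [^] n) \<otimes> inv (ev W)"
      using nat_pow_Suc2[of "ev P" n] by simp
    also have "\<dots> = ev P \<otimes> ev T" unfolding T by (simp add: m_assoc)
    finally have "T @ P' = P @ T" using ev_inj[of "T @ P'" "P @ T"] by simp
    then show ?thesis using 1 nf(1) by (intro exI[of _ n] exI[of _ T] bexI[of _ "c \<otimes> z"]) simp_all
  qed
qed

section \<open>Pairs of half-twists up to simultaneous conjugation\<close>

text \<open>This is \<open>b \<otimes> a \<otimes> inv b\<close>, the conjugate of \<open>\<sigma>\<^sub>1\<close> whose half-twist joins the two outer strands.\<close>

definition t :: 'g where "t = b \<otimes> (b \<otimes> D)"

lemma t_carrier [simp]: "t \<in> carrier G"
  by (simp add: t_def)

definition antipalindrome :: "bool list \<Rightarrow> bool list" where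
  "antipalindrome V = [True, True] @ V @ [True, True] @ flip V"

text \<open>The three shapes of a factorization of \<open>X\<close> with first factor \<open>x\<close>. The second factor is
  \<open>inv x \<otimes> X\<close>, so it is left out.\<close>

definition standard :: "'g \<Rightarrow> 'g \<Rightarrow> bool" where
  "standard x X \<longleftrightarrow> (\<exists>g\<in>carrier G.
     x = conj_by g a \<and> X = conj_by g (a \<otimes> a) \<or>
     x = conj_by g a \<and> X = conj_by g (a \<otimes> inv b) \<or>
     (\<exists>V. x = conj_by g t \<and> X = conj_by g (z \<otimes> ev (antipalindrome V))))"

lemma standard_conj_by:
  assumes "standard x X" "h \<in> carrier G"
  shows "standard (conj_by h x) (conj_by h X)"
proof -
  obtain g where g: "g \<in> carrier G"
    "x = conj_by g a \<and> X = conj_by g (a \<otimes> a) \<or> x = conj_by g a \<and> X = conj_by g (a \<otimes> inv b) \<or>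
     (\<exists>V. x = conj_by g t \<and> X = conj_by g (z \<otimes> ev (antipalindrome V)))"
    using assms(1) unfolding standard_def by blast
  have c: "conj_by h (conj_by g y) = conj_by (h \<otimes> g) y" if "y \<in> carrier G" for y
    using that assms(2) g(1) by (rule conj_by_conj_by[rotated 2])
  show ?thesis
    unfolding standard_def
  proof (rule bexI[of _ "h \<otimes> g"])
    show "h \<otimes> g \<in> carrier G" using assms(2) g(1) by simp
    show "conj_by h x = conj_by (h \<otimes> g) a \<and> conj_by h X = conj_by (h \<otimes> g) (a \<otimes> a) \<or>
      conj_by h x = conj_by (h \<otimes> g) a \<and> conj_by h X = conj_by (h \<otimes> g) (a \<otimes> inv b) \<or>
      (\<exists>V. conj_by h x = conj_by (h \<otimes> g) t \<and> conj_by h X = conj_by (h \<otimes> g) (z \<otimes> ev (antipalindrome V)))"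
      using g(2) by (elim disjE conjE exE) (simp_all only: c carrier m_closed inv_closed t_carrier ev_carrier, blast+)
  qed
qed

text \<open>By simultaneous conjugation the first factor may be taken to be \<open>a\<close>, so it suffices to treat
  \<open>a \<otimes> conj_by h a\<close> for each \<open>h\<close>. Since \<open>a\<close> commutes with itself, \<open>h\<close> matters only up to powers of
  \<open>a\<close> on both sides.\<close>

abbreviation standard_translate :: "'g \<Rightarrow> bool" where
  "standard_translate h \<equiv> standard a (a \<otimes> conj_by h a)"

lemma conj_by_a_a: "conj_by a a = a" "conj_by (inv a) a = a"
  by (simp_all add: conj_by_def m_assoc)

lemma conj_by_mult_a: "h \<in> carrier G \<Longrightarrow> conj_by (h \<otimes> a) a = conj_by h a"
    "h \<in> carrier G \<Longrightarrow> conj_by (h \<otimes> inv a) a = conj_by h a"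
  by (simp_all flip: conj_by_conj_by add: conj_by_a_a)

lemma standard_translate_left:
  assumes "standard_translate h" "h \<in> carrier G"
  shows "standard_translate (a \<otimes> h)" "standard_translate (inv a \<otimes> h)"
proof -
  have eq: "conj_by c (a \<otimes> conj_by h a) = a \<otimes> conj_by (c \<otimes> h) a" if "c = a \<or> c = inv a" for c
    using that assms(2) by (auto simp: conj_by_mult conj_by_conj_by conj_by_a_a)
  show "standard_translate (a \<otimes> h)" using standard_conj_by[OF assms(1), of a] eq[of a] conj_by_a_a by simp
  show "standard_translate (inv a \<otimes> h)" using standard_conj_by[OF assms(1), of "inv a"] eq[of "inv a"] conj_by_a_a by simp
qed

lemma inv_b_a: "inv b \<otimes> a = D \<otimes> b"
  using bDb by (simp add: inv_solve_left' m_assoc)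

lemma a_inv_b: "a \<otimes> inv b = b \<otimes> D"
  using bDb by (simp add: inv_solve_right')

text \<open>The product \<open>D a D\<close> is \<open>\<sigma>\<^sub>2\<close> up to a central factor, and \<open>\<sigma>\<^sub>2\<sigma>\<^sub>1\<sigma>\<^sub>2\<inverse> = \<sigma>\<^sub>1\<inverse>\<sigma>\<^sub>2\<sigma>\<^sub>1\<close>, so the pair is
  conjugate to \<open>\<sigma>\<^sub>1, \<sigma>\<^sub>2\<close>.\<close>

lemma standard_translate_D_a_D: "standard_translate (D \<otimes> (a \<otimes> D))"
proof -
  have "conj_by (D \<otimes> (a \<otimes> D)) a = conj_by (z \<otimes> inv b) a"
    by (simp add: D_moves(3) m_assoc)
  also have "\<dots> = conj_by (inv b) a" by (simp only: conj_by_center_mult z_center inv_closed carrier)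
  finally have "a \<otimes> conj_by (D \<otimes> (a \<otimes> D)) a = a \<otimes> (inv b \<otimes> a \<otimes> b)" by (simp add: conj_by_def)
  also have "\<dots> = (a \<otimes> inv b) \<otimes> (a \<otimes> b)" by (simp add: m_assoc)
  also have "\<dots> = (b \<otimes> D \<otimes> a) \<otimes> b" unfolding a_inv_b by (simp add: m_assoc)
  also have "\<dots> = inv b \<otimes> a" unfolding bDa inv_b_a ..
  also have "\<dots> = conj_by (inv a) (a \<otimes> inv b)" by (simp add: conj_by_def m_assoc)
  finally show ?thesis unfolding standard_def
    using conj_by_a_a(2) by (intro bexI[of _ "inv a"]) (auto)
qed

lemma flip_ev: "ev (flip V) = D \<otimes> (inv (ev V) \<otimes> inv D)"
proof -
  have "ev (flip V) = (ev (flip V) \<otimes> D) \<otimes> inv D" by (simp add: m_assoc)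
  then show ?thesis unfolding ev_D by (simp add: m_assoc)
qed

text \<open>The generic case, and the source of the word \<open>bb V bb V*\<close>. Conjugating by \<open>b\<close> turns \<open>a\<close> into \<open>t\<close> and
  \<open>h\<close> into \<open>D V\<close>, up to a central factor and a power of \<open>t\<close> on the right. Then \<open>t D V t V\<inverse> D\<inverse>\<close>
  is \<open>bb DD V bb (D V\<inverse> D\<inverse>)\<close>, whose last factor is \<open>V*\<close>.\<close>

lemma standard_translate_main: "standard_translate (D \<otimes> (ev ([False] @ V @ [False]) \<otimes> D))"
proof -
  define h where "h = D \<otimes> (ev ([False] @ V @ [False]) \<otimes> D)"
  have h: "h \<in> carrier G" by (simp add: h_def)
  have a: "a = conj_by (inv b) t" by (simp add: conj_by_def t_def flip: bDb)
  have t_inv: "D \<otimes> (inv b \<otimes> inv b) = z \<otimes> inv t"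
    by (simp add: t_def inv_mult_group m_assoc)
  have "b \<otimes> (h \<otimes> inv b) = (b \<otimes> D \<otimes> a) \<otimes> (ev V \<otimes> ((a \<otimes> D) \<otimes> inv b))"
    by (simp add: h_def letter_def m_assoc)
  also have "\<dots> = D \<otimes> (ev V \<otimes> (D \<otimes> (inv b \<otimes> inv b)))"
    unfolding bDa D_moves(3) by (simp add: m_assoc)
  also have "\<dots> = z \<otimes> (D \<otimes> (ev V \<otimes> inv t))"
    unfolding t_inv by (simp only: center_left_commute[of z] z_center carrier ev_carrier inv_closed t_carrier m_closed)
  finally have bhb: "b \<otimes> (h \<otimes> inv b) = z \<otimes> (D \<otimes> (ev V \<otimes> inv t))" .
  have tt: "conj_by (inv t) t = t" by (simp add: conj_by_def)
  have "conj_by h a = conj_by (inv b) (conj_by (b \<otimes> (h \<otimes> inv b)) t)"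
    unfolding a using h by (simp add: conj_by_conj_by)
  also have "conj_by (b \<otimes> (h \<otimes> inv b)) t = conj_by (D \<otimes> (ev V \<otimes> inv t)) t"
    unfolding bhb by (simp only: conj_by_center_mult z_center carrier ev_carrier inv_closed t_carrier m_closed)
  also have "\<dots> = conj_by (D \<otimes> ev V) t"
    using tt by (simp add: m_assoc flip: conj_by_conj_by)
  finally have "conj_by h a = conj_by (inv b) (conj_by (D \<otimes> ev V) t)" .
  then have "a \<otimes> conj_by h a = conj_by (inv b) (t \<otimes> conj_by (D \<otimes> ev V) t)"
    by (subst (1) a) (simp add: conj_by_mult)
  also have "t \<otimes> conj_by (D \<otimes> ev V) t = b \<otimes> (b \<otimes> (z \<otimes> (ev V \<otimes> (b \<otimes> (b \<otimes> (D \<otimes> (inv (ev V) \<otimes> inv D)))))))"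
    by (simp add: conj_by_def t_def m_assoc inv_mult_group)
  also have "\<dots> = z \<otimes> (b \<otimes> (b \<otimes> (ev V \<otimes> (b \<otimes> (b \<otimes> ev (flip V))))))"
    unfolding flip_ev[symmetric]
    by (simp only: center_left_commute[of z] z_center carrier ev_carrier m_closed)
  also have "\<dots> = z \<otimes> ev (antipalindrome V)"
    by (simp add: antipalindrome_def letter_def m_assoc)
  finally have "a \<otimes> conj_by h a = conj_by (inv b) (z \<otimes> ev (antipalindrome V))" .
  then show ?thesis
    unfolding standard_def h_def[symmetric] using a by (intro bexI[of _ "inv b"]) auto
qed

lemma standard_translate_one: "standard_translate \<one>"
  unfolding standard_def by (intro bexI[of _ \<one>]) auto

lemma standard_translate_center: "c \<in> center \<Longrightarrow> h \<in> carrier G \<Longrightarrow> standard_translate h \<Longrightarrow> standard_translate (c \<otimes> h)"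
  by (simp only: conj_by_center_mult carrier)

text \<open>A letter \<open>b\<close> at either end of \<open>W\<close> turns into \<open>inv a\<close> when it is moved out across \<open>D\<close>, and powers of \<open>a\<close>
  may be dropped. What remains is empty or begins and ends with \<open>a\<close>.\<close>

lemma standard_translate_D_ev_D: "standard_translate (D \<otimes> (ev W \<otimes> D))"
proof (induction "length W" arbitrary: W rule: less_induct)
  case less
  consider "W = []" | V where "W = True # V" | V where "W = V @ [True]" | "W = [False]"
    | V where "W = [False] @ V @ [False]"
    by (cases W; cases "tl W" rule: rev_cases) auto
  then show ?case
  proof cases
    case 1
    then show ?thesis using standard_translate_center[OF z_center _ standard_translate_one] by simp
  next
    case 2
    have "D \<otimes> (ev W \<otimes> D) = (D \<otimes> b) \<otimes> (ev V \<otimes> D)" by (simp add: 2 letter_def m_assoc)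
    also have "\<dots> = inv a \<otimes> (D \<otimes> (ev V \<otimes> D))" unfolding D_moves(2) by (simp add: m_assoc)
    finally show ?thesis using standard_translate_left(2)[OF less.hyps[of V]] 2 by simp
  next
    case 3
    have "D \<otimes> (ev W \<otimes> D) = D \<otimes> (ev V \<otimes> (b \<otimes> D))" by (simp add: 3 letter_def m_assoc)
    also have "\<dots> = D \<otimes> (ev V \<otimes> D) \<otimes> inv a" unfolding D_moves(4) by (simp add: m_assoc)
    finally have eq: "D \<otimes> (ev W \<otimes> D) = D \<otimes> (ev V \<otimes> D) \<otimes> inv a" .
    have "standard_translate (D \<otimes> (ev V \<otimes> D))" using less.hyps 3 by simp
    then show ?thesis unfolding eq by (simp only: conj_by_mult_a m_closed carrier ev_carrier)
  next
    case 4
    then show ?thesis using standard_translate_D_a_D by (simp add: letter_def)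
  next
    case 5
    then show ?thesis using standard_translate_main[of V] by simp
  qed
qed

text \<open>Rewriting a letter \<open>b\<close> in this way creates the \<open>D\<close> that the other normal forms lack, so they reduce to
  \<open>D W D\<close> and the two elements \<open>\<one>\<close> and \<open>D\<close>.\<close>

lemma b_eq: "b = inv z \<otimes> (a \<otimes> (D \<otimes> a))"
  using aDa by (simp add: inv_solve_left m_assoc)

lemma standard_translate_D: "standard_translate D"
proof -
  have "conj_by D a = inv b" by (simp add: conj_by_def D_moves(1)) (simp add: m_assoc)
  then show ?thesis unfolding standard_def by (intro bexI[of _ \<one>]) auto
qed

lemma standard_translate_D_ev: "standard_translate (D \<otimes> ev W)"
proof (induction W rule: rev_induct)
  case Nil
  then show ?case using standard_translate_D by simp
next
  case (snoc l W)
  show ?case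
  proof (cases l)
    case False
    have "D \<otimes> ev (W @ [l]) = D \<otimes> ev W \<otimes> a" using False by (simp add: letter_def m_assoc)
    then show ?thesis using snoc by (simp only: conj_by_mult_a m_closed carrier ev_carrier)
  next
    case True
    have "D \<otimes> ev (W @ [l]) = D \<otimes> (ev W \<otimes> b)" using True by (simp add: letter_def)
    also have "\<dots> = D \<otimes> (ev W \<otimes> (inv z \<otimes> (a \<otimes> (D \<otimes> a))))" by (subst b_eq) simp
    also have "\<dots> = inv z \<otimes> (D \<otimes> (ev W \<otimes> (a \<otimes> (D \<otimes> a))))"
      by (simp only: center_left_commute[of "inv z"] center_inv z_center carrier ev_carrier m_closed)
    also have "\<dots> = inv z \<otimes> ((D \<otimes> (ev (W @ [False]) \<otimes> D)) \<otimes> a)"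
      by (simp add: letter_def m_assoc del: inv_mult_group)
    finally show ?thesis
      using standard_translate_D_ev_D[of "W @ [False]"]
      by (simp only: conj_by_mult_a conj_by_center_mult center_inv z_center m_closed carrier ev_carrier)
  qed
qed

lemma standard_translate_ev_and_ev_D: "standard_translate (ev W)" "standard_translate (ev W \<otimes> D)"
proof (induction W)
  case Nil
  show "standard_translate (ev [])" "standard_translate (ev [] \<otimes> D)" using standard_translate_one standard_translate_D by simp_all
next
  case (Cons l W)
  have b: "ev (True # W) \<otimes> y = inv z \<otimes> (a \<otimes> (D \<otimes> (ev (False # W) \<otimes> y)))" if "y \<in> carrier G" for y
  proof -
    have "ev (True # W) \<otimes> y = b \<otimes> (ev W \<otimes> y)" using that by (simp add: letter_def m_assoc)
    also have "\<dots> = (inv z \<otimes> (a \<otimes> (D \<otimes> a))) \<otimes> (ev W \<otimes> y)" by (subst b_eq) simp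
    finally show ?thesis using that by (simp add: letter_def m_assoc del: inv_mult_group)
  qed
  have b1: "ev (True # W) = inv z \<otimes> (a \<otimes> (D \<otimes> ev (False # W)))"
    using b[of \<one>] by simp
  have b2: "ev (True # W) \<otimes> D = inv z \<otimes> (a \<otimes> (D \<otimes> (ev (False # W) \<otimes> D)))"
    using b[of D] by simp
  have c: "standard_translate (inv z \<otimes> (a \<otimes> h))" if "standard_translate h" "h \<in> carrier G" for h
    using that by (intro standard_translate_center standard_translate_left) auto
  show "standard_translate (ev (l # W))"
  proof (cases "l = True")
    case True
    show ?thesis unfolding True b1 by (intro c standard_translate_D_ev) simp
  next
    case False
    then show ?thesis using standard_translate_left(1)[OF Cons.IH(1)] by (simp add: letter_def)
  qed
  show "standard_translate (ev (l # W) \<otimes> D)"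
  proof (cases "l = True")
    case True
    show ?thesis unfolding True b2 by (intro c standard_translate_D_ev_D) simp
  next
    case False
    then show ?thesis using standard_translate_left(1)[OF Cons.IH(2)] by (simp add: letter_def m_assoc)
  qed
qed

lemma standard_translate_all:
  assumes "h \<in> carrier G"
  shows "standard_translate h"
proof -
  obtain c w x y where h: "c \<in> center" "x \<in> {\<one>, D}" "y \<in> {\<one>, D}" "h = c \<otimes> (x \<otimes> (ev w \<otimes> y))"
    using normal_form[OF assms] unfolding normal_form_def by blast
  have "standard_translate (x \<otimes> (ev w \<otimes> y))"
    using h(2,3) standard_translate_ev_and_ev_D[of w] standard_translate_D_ev[of w] standard_translate_D_ev_D[of w] by auto
  then show ?thesis unfolding h(4) by (rule standard_translate_center[rotated 2]) (use h(1-3) in auto)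
qed

lemma factor_standard:
  assumes "g \<in> carrier G" "h \<in> carrier G" "x = conj_by g a" "X \<in> carrier G" "inv x \<otimes> X = conj_by h a"
  shows "standard x X"
proof -
  have "X = x \<otimes> conj_by h a" using assms by (simp flip: assms(5))
  also have "\<dots> = conj_by g (a \<otimes> conj_by (inv g \<otimes> h) a)"
    using assms(1,2) unfolding assms(3) by (simp add: conj_by_mult conj_by_conj_by)
  finally show ?thesis
    using standard_conj_by[OF standard_translate_all[of "inv g \<otimes> h"], of g] assms(1-3) by simp
qed

section \<open>Factorizations of a given product\<close>

lemma trace_rho: "\<rho> (a \<otimes> inv b) = (0, 1, - 1, 1)" "\<rho> (a \<otimes> a) = (1, 2, 0, 1)" "\<rho> z = (- 1, 0, 0, - 1)"
  by (simp_all add: rho_mult rho_a rho_inv_b rho_D)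

text \<open>The matrix of \<open>z\<close> is \<open>-1\<close>, and both diagonal entries of a positive word are at least \<open>1\<close>.\<close>

lemma trace_z_ev: "trace (z \<otimes> ev w) \<le> - 2"
proof -
  obtain p q r s where "\<rho> (ev w) = (p, q, r, s)" "1 \<le> p" "0 \<le> q" "0 \<le> r" "1 \<le> s"
    by (rule rho_ev)
  then show ?thesis
    unfolding trace_def by (subst rho_mult) (simp_all add: trace_rho(3) del: m_closed)
qed

text \<open>The traces show that a product never admits two of the three shapes.\<close>

lemma standard_cases:
  assumes "standard x X"
  obtains g where "g \<in> carrier G" "trace X = 2" "x = conj_by g a" "X = conj_by g (a \<otimes> a)"
  | g where "g \<in> carrier G" "trace X = 1" "x = conj_by g a" "X = conj_by g (a \<otimes> inv b)"
  | g V where "g \<in> carrier G" "trace X \<le> - 2" "x = conj_by g t" "X = conj_by g (z \<otimes> ev (antipalindrome V))"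
proof -
  obtain g where g: "g \<in> carrier G"
    "x = conj_by g a \<and> X = conj_by g (a \<otimes> a) \<or> x = conj_by g a \<and> X = conj_by g (a \<otimes> inv b) \<or>
     (\<exists>V. x = conj_by g t \<and> X = conj_by g (z \<otimes> ev (antipalindrome V)))"
    using assms unfolding standard_def by blast
  have "trace (conj_by g (a \<otimes> a)) = 2" "trace (conj_by g (a \<otimes> inv b)) = 1"
    "trace (conj_by g (z \<otimes> ev w)) \<le> - 2" for w
    using g(1) trace_conj_by[of g "a \<otimes> a"] trace_conj_by[of g "a \<otimes> inv b"]
      trace_conj_by[of g "z \<otimes> ev w"] trace_z_ev[of w] trace_rho
    by (simp_all add: trace_def)
  with g that show thesis by blast
qed

lemma conj_by_conj_by_quotient:
  assumes "g \<in> carrier G" "h \<in> carrier G" "y \<in> carrier G" "y' \<in> carrier G"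
    and "conj_by g y = conj_by h y'"
  shows "(inv g \<otimes> h) \<otimes> y' = y \<otimes> (inv g \<otimes> h)"
proof -
  have "conj_by (inv g \<otimes> h) y' = conj_by (inv g) (conj_by g y)"
    unfolding assms(5) using assms(1-4) by (simp add: conj_by_conj_by)
  also have "\<dots> = y" using assms(1-4) by (simp add: conj_by_conj_by)
  finally show ?thesis using assms by (simp add: conj_by_fixes_iff)
qed

lemma conj_by_split:
  assumes "g \<in> carrier G" "h \<in> carrier G" "y \<in> carrier G"
  shows "conj_by h y = conj_by g (conj_by (inv g \<otimes> h) y)"
  using assms by (simp add: conj_by_conj_by)

lemma nat_pow_fixes:
  assumes "d \<in> carrier G" "y \<in> carrier G" "conj_by d y = y"
  shows "conj_by (d [^] (n::nat)) y = y"
  using assms by (induction n) (simp_all flip: conj_by_conj_by)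

text \<open>An element commuting with \<open>a\<^sup>2\<close> is, up to central factors and powers of \<open>a\<^sup>2\<close>, a positive word commuting
  with the word \<open>aa\<close>, hence a power of \<open>a\<close>.\<close>

lemma square_factor_unique:
  assumes g: "g \<in> carrier G" and h: "h \<in> carrier G" and eq: "conj_by g (a \<otimes> a) = conj_by h (a \<otimes> a)"
  shows "conj_by g a = conj_by h a"
proof -
  define k where "k = inv g \<otimes> h"
  have k: "k \<in> carrier G" using g h by (simp add: k_def)
  have "k \<otimes> ev [False, False] = ev [False, False] \<otimes> k"
    using conj_by_conj_by_quotient[OF g h _ _ eq] by (simp add: k_def letter_def)
  from positive_words_conjugate[OF k this] obtain n T c where
    T: "c \<in> center" "ev [False, False] [^] (n::nat) \<otimes> k = c \<otimes> ev T" "T @ [False, False] = [False, False] @ T"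
    by blast
  have FF: "\<not> [False, False] ! j" if "j < 2" for j
    using that by (auto simp: less_2_cases_iff)
  have "\<not> T ! i" if "i < length T" for i
    using conjugate_words_periodic(1)[OF T(3) _ that] FF[of "i mod 2"] by (simp add: numeral_2_eq_2)
  then have "\<forall>l\<in>set T. \<not> l" by (metis in_set_conv_nth)
  then have Ta: "conj_by (ev T) a = a"
  proof (induction T)
    case (Cons l T)
    have "conj_by (ev (l # T)) a = conj_by a (conj_by (ev T) a)"
      using Cons.prems by (simp add: letter_def conj_by_conj_by)
    also have "conj_by (ev T) a = a" 
    proof (rule Cons.IH, rule ballI)
      show "\<not> m" if "m \<in> set T" for m using Cons.prems that by (metis list.set_intros(2))
    qed
    finally show ?case by (simp only: conj_by_a_a)
  qed simp
  define d where "d = ev [False, False] [^] (n::nat)"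
  have d: "d \<in> carrier G" "conj_by d a = a"
    unfolding d_def using conj_by_a_a
    by (simp, intro nat_pow_fixes) (simp_all add: letter_def flip: conj_by_conj_by)
  have "conj_by (d \<otimes> k) a = a"
    unfolding d_def T(2) using T(1) Ta by (simp add: conj_by_center_mult)
  then have "conj_by d (conj_by k a) = conj_by d a" using d k by (simp add: conj_by_conj_by)
  then have "conj_by k a = a" using d(1) k by (simp add: conj_by_def)
  then show ?thesis using conj_by_split[OF g h, of a] by (simp add: k_def)
qed

text \<open>The product \<open>\<sigma>\<^sub>1\<sigma>\<^sub>2\<close>, which has order three modulo the center. Its powers absorb the occurrences of \<open>D\<close>
  in a normal form, so up to a central factor every element is a positive word
  between two powers of \<open>\<delta>\<close>.\<close>

abbreviation \<delta> :: 'g where "\<delta> \<equiv> a \<otimes> inv b"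

lemma delta_D: "\<delta> \<otimes> a = D" "b \<otimes> D = \<delta>" "a \<otimes> D = \<delta> \<otimes> \<delta>"
proof -
  show 1: "b \<otimes> D = \<delta>" by (rule a_inv_b[symmetric])
  show "\<delta> \<otimes> a = D" unfolding a_inv_b by (rule bDa)
  have "\<delta> \<otimes> \<delta> = (b \<otimes> D \<otimes> b) \<otimes> D" unfolding a_inv_b by (simp add: m_assoc)
  then show "a \<otimes> D = \<delta> \<otimes> \<delta>" unfolding bDb by simp
qed

lemma ev_D_delta_form: "\<exists>i U j. ev w \<otimes> D = \<delta> [^] (i::nat) \<otimes> (ev U \<otimes> \<delta> [^] (j::nat))"
proof (cases w rule: rev_cases)
  case Nil
  have "ev w \<otimes> D = \<delta> [^] (1::nat) \<otimes> (ev [False] \<otimes> \<delta> [^] (0::nat))"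
    using delta_D(1) by (simp add: Nil letter_def)
  then show ?thesis by blast
next
  case (snoc v l)
  have "ev w \<otimes> D = \<delta> [^] (0::nat) \<otimes> (ev v \<otimes> \<delta> [^] (if l then 1 else 2::nat))"
    using delta_D(2,3) by (simp add: snoc letter_def m_assoc numeral_2_eq_2)
  then show ?thesis by blast
qed

lemma delta_form:
  assumes "h \<in> carrier G"
  shows "\<exists>c\<in>center. \<exists>i U j. h = c \<otimes> (\<delta> [^] (i::nat) \<otimes> (ev U \<otimes> \<delta> [^] (j::nat)))"
proof -
  obtain c w x y where h: "c \<in> center" "x \<in> {\<one>, D}" "y \<in> {\<one>, D}" "h = c \<otimes> (x \<otimes> (ev w \<otimes> y))"
    using normal_form[OF assms] unfolding normal_form_def by blast
  have right: "\<exists>i U j. ev v \<otimes> y = \<delta> [^] (i::nat) \<otimes> (ev U \<otimes> \<delta> [^] (j::nat))" for v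
  proof (cases "y = \<one>")
    case True
    have "ev v \<otimes> y = \<delta> [^] (0::nat) \<otimes> (ev v \<otimes> \<delta> [^] (0::nat))" by (simp add: True)
    then show ?thesis by blast
  next
    case False
    then show ?thesis using h(3) ev_D_delta_form by simp
  qed
  have "\<exists>i U j. x \<otimes> (ev w \<otimes> y) = \<delta> [^] (i::nat) \<otimes> (ev U \<otimes> \<delta> [^] (j::nat))"
  proof (cases "x = \<one>")
    case True
    then have "x \<otimes> (ev w \<otimes> y) = ev w \<otimes> y" using h(3) by auto
    then show ?thesis using right[of w] by simp
  next
    case False
    then have "x \<otimes> (ev w \<otimes> y) = (\<delta> \<otimes> a) \<otimes> (ev w \<otimes> y)" using h(2) delta_D(1) by simp
    also have "\<dots> = \<delta> \<otimes> (ev (False # w) \<otimes> y)" using h(3) by (auto simp: letter_def m_assoc)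
    finally have 1: "x \<otimes> (ev w \<otimes> y) = \<delta> \<otimes> (ev (False # w) \<otimes> y)" .
    obtain i U j where 2: "ev (False # w) \<otimes> y = \<delta> [^] (i::nat) \<otimes> (ev U \<otimes> \<delta> [^] (j::nat))"
      using right by blast
    have "x \<otimes> (ev w \<otimes> y) = \<delta> [^] (Suc i) \<otimes> (ev U \<otimes> \<delta> [^] j)"
      unfolding 1 2 by (subst nat_pow_Suc2) (simp_all add: m_assoc del: nat_pow_Suc)
    then show ?thesis by blast
  qed
  then obtain i U j where "x \<otimes> (ev w \<otimes> y) = \<delta> [^] (i::nat) \<otimes> (ev U \<otimes> \<delta> [^] (j::nat))" by blast
  then have "h = c \<otimes> (\<delta> [^] i \<otimes> (ev U \<otimes> \<delta> [^] j))" using h(4) by (simp only:)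
  then show ?thesis using h(1) by blast
qed

text \<open>After removing powers of \<open>\<delta>\<close>, a positive word remains that commutes with \<open>\<delta>\<close>. A matrix commuting
  with that of \<open>\<delta>\<close> has off-diagonal entries of opposite sign, while those of a positive word are
  nonnegative; so the matrix is scalar and the word empty.\<close>

lemma delta_centralizer:
  assumes h: "h \<in> carrier G" and eq: "h \<otimes> \<delta> = \<delta> \<otimes> h"
  shows "\<exists>c\<in>center. \<exists>n. h = c \<otimes> \<delta> [^] (n::nat)"
proof -
  obtain c i U j where c: "c \<in> center" "h = c \<otimes> (\<delta> [^] (i::nat) \<otimes> (ev U \<otimes> \<delta> [^] (j::nat)))"
    using delta_form[OF h] by blast
  define e where "e = \<delta>"
  have e: "e \<in> carrier G" by (simp add: e_def)
  have pw: "e [^] n \<otimes> e = e \<otimes> e [^] n" for n :: nat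
    using e nat_pow_Suc2[of e n] by simp
  have hh: "h = c \<otimes> (e [^] i \<otimes> (ev U \<otimes> e [^] j))" using c(2) by (simp add: e_def)
  have "c \<otimes> (e [^] i \<otimes> ((ev U \<otimes> e) \<otimes> e [^] j)) = h \<otimes> e"
    unfolding hh using c(1) e pw[of j] by (simp add: m_assoc)
  also have "\<dots> = e \<otimes> h" using eq by (simp add: e_def)
  also have "\<dots> = c \<otimes> (e \<otimes> (e [^] i \<otimes> (ev U \<otimes> e [^] j)))"
    unfolding hh using c(1) e by (simp add: center_left_commute[of c])
  also have "\<dots> = c \<otimes> ((e \<otimes> e [^] i) \<otimes> (ev U \<otimes> e [^] j))" using e by (simp add: m_assoc)
  also have "\<dots> = c \<otimes> (e [^] i \<otimes> ((e \<otimes> ev U) \<otimes> e [^] j))"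
    unfolding pw[symmetric] using e by (simp add: m_assoc)
  finally have "ev U \<otimes> e = e \<otimes> ev U" using c(1) e by simp
  then have rho: "mat2_mult (\<rho> (ev U)) (0, 1, - 1, 1) = mat2_mult (0, 1, - 1, 1) (\<rho> (ev U))"
    using e rho_mult[of "ev U" e] rho_mult[of e "ev U"] trace_rho(1) by (simp add: e_def)
  obtain p q r s where U: "\<rho> (ev U) = (p, q, r, s)" "1 \<le> p" "0 \<le> q" "0 \<le> r" "1 \<le> s"
    by (rule rho_ev)
  have "- q = r" "p + q = s" using rho unfolding U(1) mat2_mult.simps prod.inject by linarith+
  then have "p + q - r - s = 0" using U(3,4) by linarith
  then have "slope (ev U) = 0" by (simp add: slope_def U(1))
  then have "U = []" by (rule slope_ev_eq_0)
  then have "h = c \<otimes> \<delta> [^] (i + j)" using hh e nat_pow_mult[of e i j] by (simp add: e_def)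
  then show ?thesis using c(1) by blast
qed

text \<open>A factorization \<open>X = x \<otimes> y\<close> is determined by \<open>x\<close>, and the Hurwitz move replaces \<open>x\<close> by
  \<open>x \<otimes> y \<otimes> inv x = X \<otimes> inv x\<close>. Arguing with functions constant under this move, rather than with the
  orbit relation, makes the symmetry and transitivity of the relation automatic.\<close>

definition hurwitz_invariant :: "'g \<Rightarrow> ('g \<Rightarrow> 'c) \<Rightarrow> bool" where
  "hurwitz_invariant X f \<longleftrightarrow> (\<forall>x\<in>carrier G. f (X \<otimes> inv x) = f x)"

text \<open>The square of the Hurwitz move is conjugation by the product.\<close>

lemma hurwitz_invariant_conj_by:
  assumes f: "hurwitz_invariant X f" and "X \<in> carrier G" "x \<in> carrier G"
  shows "f (conj_by X x) = f x"
proof -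
  have "conj_by X x = X \<otimes> inv (X \<otimes> inv x)"
    using assms(2,3) by (simp add: conj_by_def inv_mult_group m_assoc)
  then have "f (conj_by X x) = f (X \<otimes> inv x)"
    using f assms(2,3) unfolding hurwitz_invariant_def by simp
  also have "\<dots> = f x" using f assms(3) unfolding hurwitz_invariant_def by simp
  finally show ?thesis .
qed

lemma hurwitz_invariant_power:
  assumes f: "hurwitz_invariant X f" and X: "X = conj_by g (c \<otimes> d)"
    and cl: "g \<in> carrier G" "c \<in> center" "d \<in> carrier G" "y \<in> carrier G"
  shows "f (conj_by g (conj_by (d [^] (n::nat)) y)) = f (conj_by g y)"
proof (induction n)
  case 0
  then show ?case using cl by simp
next
  case (Suc n)
  let ?y = "conj_by (d [^] n) y"
  have "conj_by g (conj_by (d [^] Suc n) y) = conj_by g (conj_by d ?y)"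
    using cl nat_pow_Suc2[of d n] by (simp add: conj_by_conj_by del: nat_pow_Suc)
  also have "conj_by d ?y = conj_by (c \<otimes> d) ?y" using cl by (simp add: conj_by_center_mult)
  also have "conj_by g \<dots> = conj_by X (conj_by g ?y)"
    unfolding X using cl by (simp add: conj_by_def m_assoc inv_mult_group)
  finally have "conj_by g (conj_by (d [^] Suc n) y) = conj_by X (conj_by g ?y)" .
  then show ?case using hurwitz_invariant_conj_by[OF f, of "conj_by g ?y"] X cl Suc by simp
qed

lemma delta_factor_unique:
  assumes f: "hurwitz_invariant X f" and g: "g \<in> carrier G" and h: "h \<in> carrier G"
    and X: "X = conj_by g \<delta>" "X = conj_by h \<delta>"
  shows "f (conj_by h a) = f (conj_by g a)"
proof -
  have "(inv g \<otimes> h) \<otimes> \<delta> = \<delta> \<otimes> (inv g \<otimes> h)"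
    using conj_by_conj_by_quotient[OF g h, of \<delta> \<delta>] X by simp
  then obtain c n where c: "c \<in> center" "inv g \<otimes> h = c \<otimes> \<delta> [^] (n::nat)"
    using delta_centralizer[of "inv g \<otimes> h"] g h by auto
  have "conj_by h a = conj_by g (conj_by (inv g \<otimes> h) a)"
    using g h by (intro conj_by_split) auto
  also have "conj_by (inv g \<otimes> h) a = conj_by (\<delta> [^] n) a"
    unfolding c(2) using c(1) by (intro conj_by_center_mult) auto
  finally show ?thesis
    using hurwitz_invariant_power[OF f _ g center_one, of \<delta> a n] X(1) by simp
qed

lemma antipalindrome_length: "length (antipalindrome V) = 2 * (length V + 2)"
  by (simp add: antipalindrome_def)

text \<open>If \<open>X\<close> is written with the words \<open>P\<close> and \<open>P'\<close>, the conjugators \<open>g\<close> and \<open>h\<close> differ, up to Hurwitz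
  moves, by a prefix \<open>T\<close> of the periodic word \<open>P P \<dots>\<close>: the powers of \<open>P\<close> in \<open>positive_words_conjugate\<close> act as conjugations by \<open>X\<close>.\<close>

lemma align_factor:
  assumes f: "hurwitz_invariant X f" and g: "g \<in> carrier G" and h: "h \<in> carrier G"
    and X: "X = conj_by g (z \<otimes> ev P)" "X = conj_by h (z \<otimes> ev P')" and "P \<noteq> []"
    and y: "y \<in> carrier G"
  shows "\<exists>T. T @ P' = P @ T \<and> f (conj_by h y) = f (conj_by g (conj_by (ev T) y))"
proof -
  define k where "k = inv g \<otimes> h"
  have k: "k \<in> carrier G" using g h by (simp add: k_def)
  have "conj_by g (ev P) = conj_by h (ev P')"
  proof -
    have "z \<otimes> conj_by g (ev P) = z \<otimes> conj_by h (ev P')"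
      using X g h by (simp only: conj_by_center_arg z_center ev_carrier)
    then show ?thesis using g h by (simp del: m_assoc)
  qed
  then have "k \<otimes> ev P' = ev P \<otimes> k"
    unfolding k_def using conj_by_conj_by_quotient[OF g h, of "ev P" "ev P'"] by simp
  from positive_words_conjugate[OF k this \<open>P \<noteq> []\<close>] obtain n T c where
    T: "c \<in> center" "ev P [^] (n::nat) \<otimes> k = c \<otimes> ev T" "T @ P' = P @ T"
    by blast
  have "f (conj_by g (conj_by (ev T) y)) = f (conj_by g (conj_by (ev P [^] n \<otimes> k) y))"
    unfolding T(2) using T(1) y by (simp add: conj_by_center_mult)
  also have "conj_by (ev P [^] n \<otimes> k) y = conj_by (ev P [^] n) (conj_by k y)"
    using k y by (simp add: conj_by_conj_by)
  also have "f (conj_by g \<dots>) = f (conj_by g (conj_by k y))"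
    by (rule hurwitz_invariant_power[OF f X(1) g z_center]) (use k y in auto)
  also have "conj_by g (conj_by k y) = conj_by h y"
    using conj_by_split[OF g h y] by (simp add: k_def)
  finally show ?thesis using T(3) by auto
qed

lemma antipalindrome_product:
  "z \<otimes> ev (antipalindrome V) = conj_by (ev ([True, True] @ V)) t \<otimes> t"
proof -
  have "conj_by (ev ([True, True] @ V)) t \<otimes> t =
      b \<otimes> (b \<otimes> (ev V \<otimes> (b \<otimes> (b \<otimes> (D \<otimes> (inv (ev V) \<otimes> D))))))"
    by (simp add: conj_by_def t_def letter_def m_assoc inv_mult_group)
  also have "D \<otimes> (inv (ev V) \<otimes> D) = ev (flip V) \<otimes> z"
    unfolding flip_ev by (simp add: m_assoc)
  also have "\<dots> = z \<otimes> ev (flip V)" by (simp only: center_commute z_center ev_carrier)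
  also have "b \<otimes> (b \<otimes> (ev V \<otimes> (b \<otimes> (b \<otimes> (z \<otimes> ev (flip V)))))) =
      z \<otimes> (b \<otimes> (b \<otimes> (ev V \<otimes> (b \<otimes> (b \<otimes> ev (flip V))))))"
    by (simp only: center_left_commute[of z] z_center carrier ev_carrier m_closed)
  finally show ?thesis by (simp add: antipalindrome_def letter_def m_assoc)
qed

text \<open>Reading the cyclic word half a turn later exchanges the two factors: by \<open>antipalindrome_product\<close>
  the first factor \<open>x'\<close> at the new position and the first factor \<open>x\<close> at the old one satisfy
  \<open>x' \<otimes> x = X\<close>, so \<open>x'\<close> is the Hurwitz move of \<open>x\<close>.\<close>

lemma half_rotation:
  assumes f: "hurwitz_invariant X f" and g: "g \<in> carrier G" and X: "X = conj_by g (z \<otimes> ev P)"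
    and T: "T @ antipalindrome V = P @ T"
  defines "T' \<equiv> T @ [True, True] @ V"
  shows "T' @ antipalindrome (flip V) = P @ T'"
    and "f (conj_by g (conj_by (ev T') t)) = f (conj_by g (conj_by (ev T) t))"
proof -
  have "T' @ antipalindrome (flip V) = (T @ antipalindrome V) @ [True, True] @ V"
    by (simp add: T'_def antipalindrome_def)
  then show "T' @ antipalindrome (flip V) = P @ T'" unfolding T by (simp add: T'_def)
  define v where "v = ev ([True, True] @ V)"
  have v: "v \<in> carrier G" unfolding v_def by (rule ev_carrier)
  define x where "x = conj_by g (conj_by (ev T) t)"
  define x' where "x' = conj_by g (conj_by (ev T') t)"
  have xc: "x \<in> carrier G" "x' \<in> carrier G" using g by (simp_all add: x_def x'_def)
  have T': "ev T' = ev T \<otimes> v" unfolding T'_def v_def by (rule ev_append)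
  have "ev T \<otimes> ev (antipalindrome V) = ev P \<otimes> ev T" using T by (metis ev_append)
  then have P: "conj_by (ev T) (ev (antipalindrome V)) = ev P" by (simp add: conj_by_fixes_iff)
  have "x' \<otimes> x = conj_by g (conj_by (ev T) (conj_by v t \<otimes> t))"
    using g v by (simp add: x_def x'_def T' conj_by_mult conj_by_conj_by)
  also have "\<dots> = conj_by g (conj_by (ev T) (z \<otimes> ev (antipalindrome V)))"
    unfolding v_def antipalindrome_product ..
  also have "\<dots> = X" unfolding X by (simp only: conj_by_center_arg z_center ev_carrier P)
  finally have "X = x' \<otimes> x" ..
  then have "x' = X \<otimes> inv x" using xc by (simp add: m_assoc)
  then show "f (conj_by g (conj_by (ev T') t)) = f (conj_by g (conj_by (ev T) t))"
    using f xc by (simp add: hurwitz_invariant_def flip: x_def x'_def)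
qed

lemma half_rotations:
  assumes f: "hurwitz_invariant X f" and g: "g \<in> carrier G" and X: "X = conj_by g (z \<otimes> ev P)"
    and T: "T @ antipalindrome V = P @ T"
  shows "\<exists>T' V'. length V' = length V \<and> T' @ antipalindrome V' = P @ T' \<and>
    length T' = length T + k * (length V + 2) \<and>
    f (conj_by g (conj_by (ev T') t)) = f (conj_by g (conj_by (ev T) t))"
proof (induction k)
  case 0
  then show ?case using T by auto
next
  case (Suc k)
  then obtain T' V' where *: "length V' = length V" "T' @ antipalindrome V' = P @ T'"
    "length T' = length T + k * (length V + 2)"
    "f (conj_by g (conj_by (ev T') t)) = f (conj_by g (conj_by (ev T) t))" by blast
  show ?case
    using half_rotation[OF f g X *(2)] *
    by (intro exI[of _ "T' @ [True, True] @ V'"] exI[of _ "flip V'"]) simp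
qed

lemma rotations_congruent:
  assumes f: "hurwitz_invariant X f" and g: "g \<in> carrier G" and X: "X = conj_by g (z \<otimes> ev P)"
    and T1: "T1 @ antipalindrome V1 = P @ T1" and T2: "T2 @ antipalindrome V2 = P @ T2"
    and cong: "length T1 mod (length V1 + 2) = length T2 mod (length V1 + 2)"
    and le: "length T1 \<le> length T2"
  shows "f (conj_by g (conj_by (ev T1) t)) = f (conj_by g (conj_by (ev T2) t))"
proof -
  obtain k where k: "length T2 = length T1 + k * (length V1 + 2)"
    using cong le by (metis mod_eq_nat1E mult.commute)
  obtain T' V' where *: "T' @ antipalindrome V' = P @ T'" "length T' = length T2"
    "f (conj_by g (conj_by (ev T') t)) = f (conj_by g (conj_by (ev T1) t))"
    using half_rotations[OF f g X T1, of k] k by auto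
  have "P \<noteq> []" using T1 by (auto simp: antipalindrome_def)
  then have "T' = T2"
    using *(2) conjugate_words_periodic(1)[OF *(1)] conjugate_words_periodic(1)[OF T2]
    by (intro nth_equalityI) auto
  then show ?thesis using *(3) by simp
qed

text \<open>The trace of \<open>X\<close> tells which shape applies to all three factorizations. In the generic shape, the
  three prefixes \<open>T1\<close>, \<open>T2\<close>, \<open>T3\<close> end at antisymmetric positions of the word \<open>P\<close>, so two of their lengths
  agree modulo \<open>N\<close>.\<close>

lemma three_factors:
  assumes f: "hurwitz_invariant X f"
    and st: "standard x1 X" "standard x2 X" "standard x3 X"
  shows "f x1 = f x2 \<or> f x1 = f x3 \<or> f x2 = f x3"
  using st(1)
proof (cases rule: standard_cases)
  case (1 g)
  from st(2) 1(2) obtain h where "h \<in> carrier G" "x2 = conj_by h a" "X = conj_by h (a \<otimes> a)"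
    by (cases rule: standard_cases) auto
  then show ?thesis using square_factor_unique[of g h] 1 by simp
next
  case (2 g)
  from st(2) 2(2) obtain h where "h \<in> carrier G" "x2 = conj_by h a" "X = conj_by h \<delta>"
    by (cases rule: standard_cases) auto
  then show ?thesis using delta_factor_unique[OF f 2(1) _ 2(4), of h] 2 by simp
next
  case (3 g V)
  define P where "P = antipalindrome V"
  define N where "N = length V + 2"
  have X: "X = conj_by g (z \<otimes> ev P)" using 3(4) by (simp only: P_def)
  have lenP: "length P = 2 * N" by (simp add: P_def N_def antipalindrome_length)
  then have P: "P \<noteq> []" by (auto simp: N_def)
  have aligned: "\<exists>T W. T @ antipalindrome W = P @ T \<and> length W + 2 = N \<and>
      f x = f (conj_by g (conj_by (ev T) t))" if "standard x X" for x
  proof -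
    from that 3(2) obtain h W where h: "h \<in> carrier G" "x = conj_by h t"
      "X = conj_by h (z \<otimes> ev (antipalindrome W))"
      by (cases rule: standard_cases) auto
    obtain T where T: "T @ antipalindrome W = P @ T" "f x = f (conj_by g (conj_by (ev T) t))"
      using align_factor[OF f 3(1) h(1) X h(3) P t_carrier] h(2) by blast
    have "length W + 2 = N"
      using arg_cong[OF T(1), of length] lenP by (simp add: antipalindrome_length)
    then show ?thesis using T by blast
  qed
  obtain T1 W1 where 1: "T1 @ antipalindrome W1 = P @ T1" "length W1 + 2 = N"
      "f x1 = f (conj_by g (conj_by (ev T1) t))" using aligned[OF st(1)] by blast
  obtain T2 W2 where 2: "T2 @ antipalindrome W2 = P @ T2" "length W2 + 2 = N"
      "f x2 = f (conj_by g (conj_by (ev T2) t))" using aligned[OF st(2)] by blast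
  obtain T3 W3 where 3: "T3 @ antipalindrome W3 = P @ T3" "length W3 + 2 = N"
      "f x3 = f (conj_by g (conj_by (ev T3) t))" using aligned[OF st(3)] by blast
  have anti: "antisymmetric_at N (\<lambda>j. P ! (j mod (2 * N))) (length T)"
    if "T @ antipalindrome W = P @ T" "length W + 2 = N" for T W
    using that antisymmetric_at_word[of T W P N] by (simp add: antipalindrome_def)
  have "2 \<le> N" "P ! ((j + 2 * N) mod (2 * N)) = P ! (j mod (2 * N))" for j
    by (simp_all only: N_def le_add2 mod_add_self2)
  from antisymmetric_at_most_two[OF this anti[OF 1(1,2)] anti[OF 2(1,2)] anti[OF 3(1,2)]]
  have "length T1 mod N = length T2 mod N \<or> length T1 mod N = length T3 mod N \<or>
      length T2 mod N = length T3 mod N" .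
  moreover have "f (conj_by g (conj_by (ev T) t)) = f (conj_by g (conj_by (ev T') t))"
    if "T @ antipalindrome W = P @ T" "length W + 2 = N" "T' @ antipalindrome W' = P @ T'" "length W' + 2 = N"
      "length T mod N = length T' mod N" for T W T' W'
    using rotations_congruent[OF f \<open>g \<in> carrier G\<close> X that(1,3)]
      rotations_congruent[OF f \<open>g \<in> carrier G\<close> X that(3,1)] that
    by (cases "length T \<le> length T'") simp_all
  ultimately show ?thesis using 1 2 3 by metis
qed

end

section \<open>The braid group on three strings\<close>

text \<open>The reduced Burau representation at \<open>-1\<close>, that is, the usual map from three-string braids onto
  \<open>SL\<^sub>2(\<int>)\<close>.\<close>

fun generator_matrix :: "nat \<times> bool \<Rightarrow> mat2" where
  "generator_matrix (i, p) =
    (if i = 1 then (1, if p then 1 else - 1, 0, 1) else (1, 0, if p then - 1 else 1, 1))"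

definition word_matrix :: "nat word \<Rightarrow> mat2" where
  "word_matrix w = foldr (\<lambda>l. mat2_mult (generator_matrix l)) w (1, 0, 0, 1)"

definition braid_matrix :: "braid \<Rightarrow> mat2" where
  "braid_matrix A = word_matrix (SOME w. w \<in> A)"

lemma word_matrix_simps [simp]:
  "word_matrix [] = (1, 0, 0, 1)"
  "word_matrix (l # w) = mat2_mult (generator_matrix l) (word_matrix w)"
  by (simp_all add: word_matrix_def)

lemma word_matrix_append: "word_matrix (u @ v) = mat2_mult (word_matrix u) (word_matrix v)"
proof (induction u)
  case Nil
  then show ?case by (cases "word_matrix v") simp
qed (simp add: mat2_mult_assoc)

lemma word_matrix_pres_eq:
  "pres_eq {1..<3} (braid_relations 3) v w \<Longrightarrow> word_matrix v = word_matrix w"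
proof (induction rule: pres_eq.induct)
  case (cancel u v s p)
  have "word_matrix ([(s, p), (s, \<not> p)] @ v) = word_matrix v"
    by (cases "word_matrix v") simp
  then show ?case by (simp only: word_matrix_append)
next
  case (relator u v r r')
  then have "word_matrix r = word_matrix r'" by (auto simp: braid_relations_3)
  then show ?case by (simp only: word_matrix_append)
qed simp_all

lemma braid_matrix_cls:
  assumes "w \<in> words {1..<3}"
  shows "braid_matrix (braid.cls 3 w) = word_matrix w"
  unfolding braid_matrix_def using word_matrix_pres_eq[OF braid.rep_cls[OF assms]] by simp

lemma braid_group_generated:
  "carrier (braid_group 3) = generate (braid_group 3) {braid_gen 3 1, inv\<^bsub>braid_group 3\<^esub> braid_gen 3 2}"
    (is "_ = ?H")
proof -
  interpret B: group "braid_group 3" by (rule group_braid_group)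
  have s: "braid_gen 3 1 \<in> carrier (braid_group 3)" "braid_gen 3 2 \<in> carrier (braid_group 3)"
    by (rule braid_gen_carrier; simp)+
  have letter: "braid.cls 3 [(i, p)] \<in> ?H" if "i = 1 \<or> i = 2" for i p
  proof -
    have "inv\<^bsub>braid_group 3\<^esub> (inv\<^bsub>braid_group 3\<^esub> braid_gen 3 2) \<in> ?H"
      by (rule generate.inv) simp
    then have "braid_gen 3 2 \<in> ?H" using B.inv_inv[OF s(2)] by simp
    moreover have "braid_gen 3 1 \<in> ?H" "inv\<^bsub>braid_group 3\<^esub> braid_gen 3 2 \<in> ?H"
      by (rule generate.incl; simp)+
    moreover have "inv\<^bsub>braid_group 3\<^esub> braid_gen 3 1 \<in> ?H"
      by (rule generate.inv) simp
    ultimately have gen: "braid_gen 3 i \<in> ?H" "inv\<^bsub>braid_group 3\<^esub> braid_gen 3 i \<in> ?H"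
      using that by auto
    have w: "[(i, q)] \<in> words {1..<3}" for q using that by auto
    have "braid.cls 3 [(i, False)] \<otimes>\<^bsub>braid_group 3\<^esub> braid_gen 3 i = \<one>\<^bsub>braid_group 3\<^esub>"
    proof -
      have "braid.cls 3 [(i, False)] \<otimes>\<^bsub>braid_group 3\<^esub> braid_gen 3 i = braid.cls 3 ([(i, False)] @ [(i, True)])"
        unfolding braid_group_def braid_gen_def using w by (intro braid.cls_mult)
      also have "\<dots> = braid.cls 3 []"
        by (rule braid.cls_eq) (use pres_eq.cancel[of "[]" "{1..<3}" "[]" i "braid_relations 3" False] that in auto)
      finally show ?thesis by (simp only: braid_group_def braid.cls_one)
    qed
    moreover have "braid.cls 3 [(i, False)] \<in> carrier (braid_group 3)"
      unfolding braid_group_def by (rule braid.carrier_cls[OF w])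
    ultimately have "braid.cls 3 [(i, False)] = inv\<^bsub>braid_group 3\<^esub> braid_gen 3 i"
      using that s B.inv_equality[of "braid.cls 3 [(i, False)]" "braid_gen 3 i"] by auto
    then show ?thesis using gen by (cases p) (simp_all add: braid_gen_def)
  qed
  have cls: "braid.cls 3 w \<in> ?H" if "w \<in> words {1..<3}" for w
    using that
  proof (induction w)
    case Nil
    have "\<one>\<^bsub>braid_group 3\<^esub> \<in> ?H" by (rule generate.one)
    then show ?case by (simp only: braid_group_def braid.cls_one)
  next
    case (Cons l w)
    obtain i p where l: "l = (i, p)" by force
    have i: "i = 1 \<or> i = 2" "w \<in> words {1..<3}" "[l] \<in> words {1..<3}" using Cons.prems by (auto simp: l)
    have "braid.cls 3 (l # w) = braid.cls 3 [l] \<otimes>\<^bsub>braid_group 3\<^esub> braid.cls 3 w"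
      unfolding braid_group_def using braid.cls_mult[OF i(3,2)] by simp
    then show ?case using letter[OF i(1), of p] Cons.IH[OF i(2)] by (simp add: l generate.eng)
  qed
  have "carrier (braid_group 3) \<subseteq> ?H"
  proof
    fix A assume "A \<in> carrier (braid_group 3)"
    then obtain w where "w \<in> words {1..<3}" "A = braid.cls 3 w"
      unfolding braid_group_def by (rule braid.carrierE)
    then show "A \<in> ?H" using cls by blast
  qed
  moreover have "?H \<subseteq> carrier (braid_group 3)"
    using s by (intro B.generate_incl) auto
  ultimately show ?thesis by blast
qed

interpretation B3: three_strings "braid_group 3" "braid_gen 3 1" "inv\<^bsub>braid_group 3\<^esub> braid_gen 3 2"
  "braid_gen 3 1 \<otimes>\<^bsub>braid_group 3\<^esub> braid_gen 3 2 \<otimes>\<^bsub>braid_group 3\<^esub> braid_gen 3 1" braid_matrix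
proof -
  interpret B: group "braid_group 3" by (rule group_braid_group)
  define s1 s2 where "s1 = braid_gen 3 1" and "s2 = braid_gen 3 2"
  have s [simp]: "s1 \<in> carrier (braid_group 3)" "s2 \<in> carrier (braid_group 3)"
    unfolding s1_def s2_def by (rule braid_gen_carrier; simp)+
  define D where "D = s1 \<otimes>\<^bsub>braid_group 3\<^esub> s2 \<otimes>\<^bsub>braid_group 3\<^esub> s1"
  have D': "D = s2 \<otimes>\<^bsub>braid_group 3\<^esub> s1 \<otimes>\<^bsub>braid_group 3\<^esub> s2"
    using braid_gen_relation[of 1 3] by (simp add: D_def s1_def s2_def numeral_2_eq_2)
  have cancel: "inv\<^bsub>braid_group 3\<^esub> x \<otimes>\<^bsub>braid_group 3\<^esub> (x \<otimes>\<^bsub>braid_group 3\<^esub> y) = y"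
    if "x \<in> carrier (braid_group 3)" "y \<in> carrier (braid_group 3)" for x y
    using that by (simp flip: B.m_assoc)
  show "three_strings (braid_group 3) (braid_gen 3 1) (inv\<^bsub>braid_group 3\<^esub> braid_gen 3 2)
    (braid_gen 3 1 \<otimes>\<^bsub>braid_group 3\<^esub> braid_gen 3 2 \<otimes>\<^bsub>braid_group 3\<^esub> braid_gen 3 1) braid_matrix"
    unfolding s1_def[symmetric] s2_def[symmetric] D_def[symmetric]
  proof unfold_locales
    show "s1 \<in> carrier (braid_group 3)" "inv\<^bsub>braid_group 3\<^esub> s2 \<in> carrier (braid_group 3)"
      "D \<in> carrier (braid_group 3)"
      by (simp_all add: D_def)
    show "carrier (braid_group 3) = generate (braid_group 3) {s1, inv\<^bsub>braid_group 3\<^esub> s2}"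
      unfolding s1_def s2_def by (rule braid_group_generated)
    show "inv\<^bsub>braid_group 3\<^esub> s2 \<otimes>\<^bsub>braid_group 3\<^esub> D \<otimes>\<^bsub>braid_group 3\<^esub> s1 = D"
      by (subst D') (simp add: D_def B.m_assoc cancel)
    show "s1 \<otimes>\<^bsub>braid_group 3\<^esub> D \<otimes>\<^bsub>braid_group 3\<^esub> inv\<^bsub>braid_group 3\<^esub> s2 = D"
      by (subst D') (simp add: D_def B.m_assoc)
    show "inv\<^bsub>braid_group 3\<^esub> s2 \<otimes>\<^bsub>braid_group 3\<^esub> D \<otimes>\<^bsub>braid_group 3\<^esub> inv\<^bsub>braid_group 3\<^esub> s2 = s1"
      by (subst D') (simp add: B.m_assoc cancel)
    show one: "braid_matrix \<one>\<^bsub>braid_group 3\<^esub> = (1, 0, 0, 1)"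
      unfolding braid_group_def braid.cls_one using braid_matrix_cls[of "[]"] by simp
    show mult: "braid_matrix (x \<otimes>\<^bsub>braid_group 3\<^esub> y) = mat2_mult (braid_matrix x) (braid_matrix y)"
      if "x \<in> carrier (braid_group 3)" "y \<in> carrier (braid_group 3)" for x y
      using that unfolding braid_group_def
      by (elim braid.carrierE) (simp add: braid.cls_mult braid_matrix_cls word_matrix_append del: One_nat_def)
    show "braid_matrix s1 = (1, 1, 0, 1)"
      unfolding s1_def braid_gen_def by (subst braid_matrix_cls) auto
    have s2: "braid_matrix s2 = (1, 0, - 1, 1)"
      unfolding s2_def braid_gen_def by (subst braid_matrix_cls) auto
    obtain p q r s where m: "braid_matrix (inv\<^bsub>braid_group 3\<^esub> s2) = (p, q, r, s)" by (metis prod_cases4)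
    have "mat2_mult (braid_matrix s2) (braid_matrix (inv\<^bsub>braid_group 3\<^esub> s2)) = (1, 0, 0, 1)"
      using mult[of s2 "inv\<^bsub>braid_group 3\<^esub> s2"] one by simp
    then show "braid_matrix (inv\<^bsub>braid_group 3\<^esub> s2) = (1, 0, 1, 1)"
      unfolding s2 m by auto
  qed
qed

lemma qp_factorizations_pair:
  assumes "braid_exponent Z = 2" "xs \<in> qp_factorizations Z"
  obtains x where "x \<in> carrier (braid_group 3)" "xs = [x, inv\<^bsub>braid_group 3\<^esub> x \<otimes>\<^bsub>braid_group 3\<^esub> Z]"
    "B3.standard x Z"
proof -
  have "length xs = 2" using qp_factorizations_length[OF assms(2)] assms(1) by simp
  then obtain x y where xs: "xs = [x, y]" by (auto simp: length_Suc_conv numeral_2_eq_2)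
  have c: "x \<in> carrier (braid_group 3)" "y \<in> carrier (braid_group 3)"
    using qp_factorizations_carrier[OF assms(2)] xs by auto
  have Z: "Z = x \<otimes>\<^bsub>braid_group 3\<^esub> y"
    using assms(2) c by (simp add: xs qp_factorizations_def)
  obtain g h where gh: "g \<in> carrier (braid_group 3)" "h \<in> carrier (braid_group 3)"
    "x = B3.conj_by g (braid_gen 3 1)" "y = B3.conj_by h (braid_gen 3 1)"
    using assms(2) unfolding xs qp_factorizations_def B3.conj_by_def by auto
  have y: "inv\<^bsub>braid_group 3\<^esub> x \<otimes>\<^bsub>braid_group 3\<^esub> Z = y"
    unfolding Z using c by simp
  have "Z \<in> carrier (braid_group 3)" unfolding Z using c by simp
  then have "B3.standard x Z"
    by (rule B3.factor_standard[OF gh(1,2,3)]) (simp only: y gh(4))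
  then show thesis using that[of x] c(1) unfolding y xs by blast
qed

theorem theorem3:
  fixes Z :: braid
  assumes "Z \<in> carrier (braid_group 3)"
    and "braid_exponent Z = 2"
  shows "finite (orbits (braid_group 2) (qp_factorizations Z)
            (hurwitz_action (braid_group 3) (qp_factorizations Z))) \<and>
         card (orbits (braid_group 2) (qp_factorizations Z)
            (hurwitz_action (braid_group 3) (qp_factorizations Z))) \<le> 2"
proof -
  define E where "E = qp_factorizations Z"
  define \<phi> where "\<phi> = hurwitz_action (braid_group 3) E"
  interpret H: hurwitz_set "braid_group 3" 2 E
    using hurwitz_set_qp_factorizations[of Z] assms(2) by (simp add: E_def)
  interpret A: group_action "braid_group 2" E \<phi>
    unfolding \<phi>_def by (rule H.group_action_hurwitz)
  define pair where "pair x = [x, inv\<^bsub>braid_group 3\<^esub> x \<otimes>\<^bsub>braid_group 3\<^esub> Z]" for x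
  \<comment> \<open>Pairs outside \<open>E\<close> have no orbit; the moves preserve being outside, so a common default value is
      invariant.\<close>
  define f where "f x = (if pair x \<in> E then orbit (braid_group 2) \<phi> (pair x) else {})" for x
  have "f (Z \<otimes>\<^bsub>braid_group 3\<^esub> inv\<^bsub>braid_group 3\<^esub> x) = f x" if x: "x \<in> carrier (braid_group 3)" for x
  proof -
    let ?y = "Z \<otimes>\<^bsub>braid_group 3\<^esub> inv\<^bsub>braid_group 3\<^esub> x"
    have y: "pair ?y = [?y, x]"
      using x assms(1) by (simp add: pair_def B3.inv_mult_group B3.m_assoc)
    have move: "hurwitz_move (braid_group 3) 1 (pair x) = pair ?y"
      using hurwitz_move_split[of 1 "[]" "braid_group 3" x] x assms(1) unfolding y
      by (simp add: pair_def B3.m_assoc)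
    have move_inv: "hurwitz_move_inv (braid_group 3) 1 (pair ?y) = pair x"
      using hurwitz_move_inv_split[of 1 "[]" "braid_group 3" ?y x] x assms(1) unfolding y
      by (simp add: pair_def B3.m_assoc)
    have pair_iff: "pair ?y \<in> E \<longleftrightarrow> pair x \<in> E"
      using H.move_closed[of "pair x" 1] H.move_inv_closed[of "pair ?y" 1] move move_inv by auto
    show ?thesis
    proof (cases "pair x \<in> E")
      case True
      have "\<phi> (braid_gen 2 1) (pair x) = pair ?y"
        unfolding \<phi>_def using H.hurwitz_action_gen[of 1 "pair x"] True move by simp
      moreover have "braid_gen 2 1 \<in> carrier (braid_group 2)" by (rule braid_gen_carrier) auto
      ultimately have "pair ?y \<in> orbit (braid_group 2) \<phi> (pair x)"
        unfolding orbit_def mem_Collect_eq by metis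
      moreover have "pair ?y \<in> orbit (braid_group 2) \<phi> (pair ?y)"
        using A.orbit_refl pair_iff True by blast
      moreover have "orbit (braid_group 2) \<phi> (pair x) \<in> orbits (braid_group 2) E \<phi>"
        "orbit (braid_group 2) \<phi> (pair ?y) \<in> orbits (braid_group 2) E \<phi>"
        using True pair_iff unfolding orbits_def by blast+
      ultimately have "orbit (braid_group 2) \<phi> (pair x) = orbit (braid_group 2) \<phi> (pair ?y)"
        using A.disjoint_union by blast
      then show ?thesis using True pair_iff by (simp add: f_def)
    next
      case False
      then show ?thesis using pair_iff by (simp add: f_def)
    qed
  qed
  then have f: "B3.hurwitz_invariant Z f" by (simp add: B3.hurwitz_invariant_def)
  have orb: "\<exists>x. B3.standard x Z \<and> Q = f x" if Q: "Q \<in> orbits (braid_group 2) E \<phi>" for Q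
  proof -
    obtain xs where xs: "xs \<in> E" "Q = orbit (braid_group 2) \<phi> xs"
      using Q unfolding orbits_def by blast
    then obtain x where "xs = pair x" "B3.standard x Z"
      using qp_factorizations_pair[OF assms(2), of xs] unfolding E_def pair_def by metis
    then show ?thesis using xs by (auto simp: f_def)
  qed
  have three: "Q1 = Q2 \<or> Q1 = Q3 \<or> Q2 = Q3"
    if Q: "Q1 \<in> orbits (braid_group 2) E \<phi>" "Q2 \<in> orbits (braid_group 2) E \<phi>"
      "Q3 \<in> orbits (braid_group 2) E \<phi>" for Q1 Q2 Q3
    using orb[OF Q(1)] orb[OF Q(2)] orb[OF Q(3)] B3.three_factors[OF f] by metis
  have "finite (orbits (braid_group 2) E \<phi>) \<and> card (orbits (braid_group 2) E \<phi>) \<le> 2"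
  proof (rule ccontr)
    assume "\<not> ?thesis"
    then obtain C where C: "C \<subseteq> orbits (braid_group 2) E \<phi>" "card C = 3"
      using infinite_arbitrarily_large[of "orbits (braid_group 2) E \<phi>" 3]
        obtain_subset_with_card_n[of 3 "orbits (braid_group 2) E \<phi>"] by fastforce
    then obtain Q1 Q2 Q3 where Q: "C = {Q1, Q2, Q3}" "Q1 \<noteq> Q2" "Q1 \<noteq> Q3" "Q2 \<noteq> Q3"
      unfolding card_3_iff by blast
    then show False using three[of Q1 Q2 Q3] C(1) by blast
  qed
  then show ?thesis by (simp only: E_def \<phi>_def)
qed

end
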